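(* Let $n\ge3$ and $\mathbf{a}=(a_1,\ldots,a_n)\in\mathbb{Z}^n$ with $a_i\ge1$ for all $i$. Then \[ h^\ast(\mathcal{C}_{C_{\mathbf{a}}};z)=\prod_{i=1}^n\bigl((1+z)^{a_i}+2a_iz(1+z)^{a_i-1}\bigr)-\prod_{i=1}^n 2a_iz(1+z)^{a_i-1}. \]
   Context: $C_{\mathbf{a}}$ is the multicycle: the graph on vertex set $[n]$ (indices taken mod $n$) having, for each $i\in[n]$, exactly $a_i$ parallel edges between $i$ and $i+1$, and no other edges. For a graph $G=(V,E)$ (finite, undirected, multiset of edges), let $\mathbb{R}^{V\cup E}$ have standard unit vectors $\mathbf{e}_\alpha$; the cosmological polytope is $\mathcal{C}_G=\mathrm{conv}(\mathbf{e}_i+\mathbf{e}_j-\mathbf{e}_f,\ \mathbf{e}_i-\mathbf{e}_j+\mathbf{e}_f,\ -\mathbf{e}_i+\mathbf{e}_j+\mathbf{e}_f : f\in E\text{ with endpoints }i,j)$, of dimension $|V|+|E|-1$. For a $d$-dimensional lattice polytope $P\subset\mathbb{R}^N$, $h^\ast(P;z)$ is defined by $1+\sum_{t\ge1}|tP\cap\mathbb{Z}^N|z^t=h^\ast(P;z)/(1-z)^{d+1}$. *)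

theory Defs
  imports
    "HOL-Analysis.Analysis"
    "HOL-Analysis.Finite_Function_Topology"
    "HOL-Computational_Algebra.Formal_Power_Series"
begin

section \<open>Finite undirected multigraphs\<close>

text \<open>Parallel edges are distinct elements of \<open>edges\<close> with the same set of endpoints; a loop at \<open>i\<close>
  is an edge with \<open>ends f = {i}\<close>.\<close>

record ('v, 'e) multigraph =
  verts :: "'v set"
  edges :: "'e set"
  ends :: "'e \<Rightarrow> 'v set"

definition wf_multigraph :: "('v, 'e) multigraph \<Rightarrow> bool" where
  "wf_multigraph G \<longleftrightarrow> finite (verts G) \<and> finite (edges G) \<and>
     (\<forall>f\<in>edges G. \<exists>i\<in>verts G. \<exists>j\<in>verts G. ends G f = {i, j})"

text \<open>The vertex after \<open>i\<close> in cyclic order on \<open>{1..n}\<close> is \<open>i mod n + 1\<close>, and \<open>(i, 0), \<dots>, (i, a i - 1)\<close>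
  are the parallel edges between \<open>i\<close> and its successor.\<close>

definition multicycle :: "nat \<Rightarrow> (nat \<Rightarrow> nat) \<Rightarrow> (nat, nat \<times> nat) multigraph" where
  "multicycle n a = \<lparr> verts = {1..n}, edges = (SIGMA i:{1..n}. {..<a i}),
     ends = (\<lambda>(i, k). {i, i mod n + 1}) \<rparr>"

lemma wf_multigraph_multicycle: "wf_multigraph (multicycle n a)"
proof -
  have "\<exists>u\<in>{1..n}. \<exists>v\<in>{1..n}. {i, i mod n + 1} = {u, v}" if "i \<in> {1..n}" for i
  proof -
    have "i mod n + 1 \<in> {1..n}" using that mod_less_divisor[of n i]
      by (auto simp: Suc_le_eq simp del: mod_less_divisor)
    with that show ?thesis by blast
  qed
  then show ?thesis by (auto simp: wf_multigraph_def multicycle_def)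
qed

lemma card_parallel_edges_multicycle:
  assumes "n \<ge> 3" "i \<in> {1..n}"
  shows "card {f \<in> edges (multicycle n a). ends (multicycle n a) f = {i, i mod n + 1}} = a i"
proof -
  have "j = i" if "j \<in> {1..n}" "{j, j mod n + 1} = {i, i mod n + 1}" for j
  proof (rule ccontr)
    assume "j \<noteq> i"
    with that(2) have "j = i mod n + 1" "i = j mod n + 1"
      by (auto simp: doubleton_eq_iff)
    moreover have "l mod n = (if l = n then 0 else l)" if "l \<in> {1..n}" for l
      using that by auto
    ultimately show False using assms that(1) by (auto split: if_splits)
  qed
  then have "(j \<in> {1..n} \<and> {j, j mod n + 1} = {i, i mod n + 1}) = (j = i)" for j
    using assms(2) by metis
  then have "{f \<in> edges (multicycle n a). ends (multicycle n a) f = {i, i mod n + 1}} = {i} \<times> {..<a i}"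
    unfolding multicycle_def by fastforce
  then show ?thesis by simp
qed

section \<open>Cosmological polytopes\<close>

text \<open>Vectors indexed by the disjoint union of vertices and edges are finitely supported functions on
  the sum type. The polytope of a multigraph \<open>G\<close> lies in the coordinate subspace of vectors supported
  on \<open>verts G <+> edges G\<close>, and integer points and dimension do not depend on whether they are taken
  there or in the whole type.\<close>

abbreviation unit_vec :: "'k \<Rightarrow> 'k \<Rightarrow>\<^sub>0 real" where
  "unit_vec k \<equiv> Poly_Mapping.single k 1"

text \<open>An edge with endpoints \<open>i, j\<close> is considered for both orders of its endpoints, which produces the
  same three points.\<close>

definition cosmological_polytope :: "('v, 'e) multigraph \<Rightarrow> ('v + 'e \<Rightarrow>\<^sub>0 real) set" where
  "cosmological_polytope G = convex hull
     (\<Union>{ {unit_vec (Inl i) + unit_vec (Inl j) - unit_vec (Inr f),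
          unit_vec (Inl i) - unit_vec (Inl j) + unit_vec (Inr f),
          - unit_vec (Inl i) + unit_vec (Inl j) + unit_vec (Inr f)}
        | i j f. f \<in> edges G \<and> ends G f = {i, j} })"

section \<open>Ehrhart series\<close>

definition integer_points :: "('k \<Rightarrow>\<^sub>0 real) set" where
  "integer_points = {x. \<forall>k. Poly_Mapping.lookup x k \<in> \<int>}"

text \<open>The dimension of the affine hull of a nonempty set. The library's \<open>aff_dim\<close> is restricted to
  types of class \<open>euclidean_space\<close>.\<close>

definition affine_dim :: "'b::real_vector set \<Rightarrow> nat" where
  "affine_dim P = dim {x - y | x y. x \<in> P \<and> y \<in> P}"

definition ehrhart_series :: "('k \<Rightarrow>\<^sub>0 real) set \<Rightarrow> int fps" where
  "ehrhart_series P = Abs_fps (\<lambda>t. if t = 0 then 1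
     else int (card ((\<lambda>x. real t *\<^sub>R x) ` P \<inter> integer_points)))"

text \<open>The defining equation \<open>ehrhart_series P = hstar P / (1 - z) ^ (d + 1)\<close>, solved for \<open>hstar P\<close>.\<close>

definition hstar :: "('k \<Rightarrow>\<^sub>0 real) set \<Rightarrow> int fps" where
  "hstar P = ehrhart_series P * (1 - fps_X) ^ (affine_dim P + 1)"

end

theory Submission
  imports Defs
begin

text \<open>A lattice point of the dilate \<open>t P\<close> is read as a transport problem on the cycle. An edge
  coordinate \<open>c \<ge> 0\<close> is a transport capacity between its endpoints, a coordinate \<open>c < 0\<close> takes
  \<open>- c\<close> from both of them; the point lies in \<open>t P\<close> iff its coordinates sum to \<open>t\<close> and some flow
  within the capacities makes what is left at every vertex nonnegative, and the flow may then be
  taken integral. The parallel edges in position \<open>i\<close> act through their total capacity \<open>C\<^sub>i\<close>. The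
  admissible flows are closed under pointwise maximum, and the largest one is characterised by:
  at every vertex \<open>i\<close> either nothing is left over or the outgoing flow equals \<open>C\<^sub>i\<close>, and the latter
  happens somewhere on the cycle. So lattice points correspond to independent choices at each \<open>i\<close>
  of edge labels, a flow and a leftover, where the choices with no saturated position are excluded;
  the dilation factor is the sum of the leftovers and of the absolute values of the labels. The two
  products are the generating functions of all choices and of the excluded ones.\<close>

unbundle no vec_syntax
unbundle fps_syntax

section \<open>Generating functions of weighted sets\<close>

definition locally_finite_weight :: "'a set \<Rightarrow> ('a \<Rightarrow> nat) \<Rightarrow> bool" where
  "locally_finite_weight A w \<longleftrightarrow> (\<forall>t. finite {x \<in> A. w x = t})"

text \<open>An infinite fibre would sum to 0 by convention, so local finiteness has to accompany
  this notion. The multiplicity \<open>m\<close> lets a number of choices of equal weight enter as a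
  coefficient instead of enlarging \<open>A\<close>.\<close>

definition weight_series :: "'a set \<Rightarrow> ('a \<Rightarrow> nat) \<Rightarrow> ('a \<Rightarrow> int) \<Rightarrow> int fps" where
  "weight_series A w m = Abs_fps (\<lambda>t. \<Sum>x | x \<in> A \<and> w x = t. m x)"

lemma weight_series_nth: "weight_series A w m $ t = (\<Sum>x | x \<in> A \<and> w x = t. m x)"
  by (simp add: weight_series_def)

lemma weight_series_one_nth: "weight_series A w (\<lambda>_. 1) $ t = int (card {x \<in> A. w x = t})"
  by (simp add: weight_series_nth)

lemma locally_finite_weight_subset:
  "locally_finite_weight A w \<Longrightarrow> B \<subseteq> A \<Longrightarrow> locally_finite_weight B w"
  unfolding locally_finite_weight_def by (auto intro: finite_subset[rotated])

lemma weight_series_bij: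
  assumes "bij_betw f A B" "\<And>x. x \<in> A \<Longrightarrow> v (f x) = w x" "\<And>x. x \<in> A \<Longrightarrow> k (f x) = m x"
  shows "weight_series B v k = weight_series A w m"
proof (rule fps_ext)
  fix t
  have "bij_betw f {x \<in> A. w x = t} {y \<in> B. v y = t}"
    by (rule bij_betw_Collect[OF assms(1)]) (simp add: assms(2))
  then have "(\<Sum>y | y \<in> B \<and> v y = t. k y) = (\<Sum>x | x \<in> A \<and> w x = t. k (f x))"
    by (rule sum.reindex_bij_betw[symmetric])
  also have "\<dots> = (\<Sum>x | x \<in> A \<and> w x = t. m x)"
    using assms(3) by (intro sum.cong) auto
  finally show "weight_series B v k $ t = weight_series A w m $ t"
    by (simp add: weight_series_nth)
qed

lemma locally_finite_weight_bij:
  assumes "bij_betw f A B" "\<And>x. x \<in> A \<Longrightarrow> v (f x) = w x" "locally_finite_weight A w"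
  shows "locally_finite_weight B v"
  unfolding locally_finite_weight_def
proof
  fix t
  have "bij_betw f {x \<in> A. w x = t} {y \<in> B. v y = t}"
    by (rule bij_betw_Collect[OF assms(1)]) (simp add: assms(2))
  then have "{y \<in> B. v y = t} = f ` {x \<in> A. w x = t}"
    by (simp add: bij_betw_def)
  then show "finite {y \<in> B. v y = t}"
    using assms(3) by (simp add: locally_finite_weight_def)
qed

text \<open>A second component that does not affect the weight is summed out and survives as a
  multiplicity.\<close>

lemma weight_series_Sigma:
  assumes "locally_finite_weight A w" "\<And>x. x \<in> A \<Longrightarrow> finite (Y x)"
  shows "weight_series (Sigma A Y) (\<lambda>z. w (fst z)) (\<lambda>_. 1) = weight_series A w (\<lambda>x. int (card (Y x)))"
proof (rule fps_ext)
  fix t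
  have "{z \<in> Sigma A Y. w (fst z) = t} = Sigma {x \<in> A. w x = t} Y" by auto
  moreover have "card (Sigma {x \<in> A. w x = t} Y) = (\<Sum>x | x \<in> A \<and> w x = t. card (Y x))"
    using assms by (intro card_SigmaI) (auto simp: locally_finite_weight_def)
  ultimately show "weight_series (Sigma A Y) (\<lambda>z. w (fst z)) (\<lambda>_. 1) $ t
      = weight_series A w (\<lambda>x. int (card (Y x))) $ t"
    by (simp add: weight_series_nth)
qed

lemma locally_finite_weight_Un:
  assumes "locally_finite_weight A w" "locally_finite_weight B w"
  shows "locally_finite_weight (A \<union> B) w"
proof -
  have "{x \<in> A \<union> B. w x = t} = {x \<in> A. w x = t} \<union> {x \<in> B. w x = t}" for t by auto
  then show ?thesis using assms by (simp add: locally_finite_weight_def)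
qed

lemma weight_series_Un_disjoint:
  assumes "locally_finite_weight A w" "locally_finite_weight B w" "A \<inter> B = {}"
  shows "weight_series (A \<union> B) w m = weight_series A w m + weight_series B w m"
proof (rule fps_ext)
  fix t
  have "{x \<in> A \<union> B. w x = t} = {x \<in> A. w x = t} \<union> {x \<in> B. w x = t}" by auto
  moreover have "sum m ({x \<in> A. w x = t} \<union> {x \<in> B. w x = t})
      = sum m {x \<in> A. w x = t} + sum m {x \<in> B. w x = t}"
    using assms by (intro sum.union_disjoint) (auto simp: locally_finite_weight_def)
  ultimately show "weight_series (A \<union> B) w m $ t = (weight_series A w m + weight_series B w m) $ t"
    by (simp add: weight_series_nth)
qed

lemma weight_series_sum:
  "weight_series A w (\<lambda>x. \<Sum>j\<in>J. m j x) = (\<Sum>j\<in>J. weight_series A w (m j))"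
  by (rule fps_ext) (simp add: weight_series_nth fps_sum_nth sum.swap[of _ J])

lemma weight_series_scale:
  "weight_series A w (\<lambda>x. of_nat q * m x) = of_nat q * weight_series A w m"
proof (rule fps_ext)
  fix t
  have "of_nat q = fps_const (int q)" by (metis fps_of_nat)
  then show "weight_series A w (\<lambda>x. of_nat q * m x) $ t = (of_nat q * weight_series A w m) $ t"
    by (simp add: weight_series_nth sum_distrib_left)
qed

lemma weight_fiber_Times:
  fixes w :: "'a \<Rightarrow> nat" and v :: "'b \<Rightarrow> nat"
  shows "{z \<in> A \<times> B. w (fst z) + v (snd z) = t}
    = (\<Union>i\<in>{0..t}. {x \<in> A. w x = i} \<times> {y \<in> B. v y = t - i})"
  by auto

lemma locally_finite_weight_Times:
  assumes "locally_finite_weight A w" "locally_finite_weight B v"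
  shows "locally_finite_weight (A \<times> B) (\<lambda>z. w (fst z) + v (snd z))"
  unfolding locally_finite_weight_def weight_fiber_Times
  using assms by (simp add: locally_finite_weight_def)

text \<open>Sorting the pairs of weight \<open>t\<close> by the weight of their first component
  gives the Cauchy product of the coefficients.\<close>

lemma weight_series_Times:
  assumes "locally_finite_weight A w" "locally_finite_weight B v"
  shows "weight_series (A \<times> B) (\<lambda>z. w (fst z) + v (snd z)) (\<lambda>z. m (fst z) * k (snd z))
    = weight_series A w m * weight_series B v k"
proof (rule fps_ext)
  fix t
  have "(\<Sum>z | z \<in> A \<times> B \<and> w (fst z) + v (snd z) = t. m (fst z) * k (snd z))
      = (\<Sum>i=0..t. \<Sum>z\<in>{x \<in> A. w x = i} \<times> {y \<in> B. v y = t - i}. m (fst z) * k (snd z))"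
    unfolding weight_fiber_Times
    by (rule sum.UNION_disjoint) (use assms in \<open>auto simp: locally_finite_weight_def\<close>)
  also have "\<dots> = (\<Sum>i=0..t. (\<Sum>x | x \<in> A \<and> w x = i. m x) * (\<Sum>y | y \<in> B \<and> v y = t - i. k y))"
    by (simp add: sum_product sum.cartesian_product case_prod_unfold)
  finally show "weight_series (A \<times> B) (\<lambda>z. w (fst z) + v (snd z)) (\<lambda>z. m (fst z) * k (snd z)) $ t
      = (weight_series A w m * weight_series B v k) $ t"
    by (simp add: weight_series_nth fps_mult_nth)
qed

text \<open>Both claims go through one induction, because the rule for a product of two sets
  requires local finiteness of both factors.\<close>

lemma weight_series_PiE:
  assumes "finite I" "\<And>i. i \<in> I \<Longrightarrow> locally_finite_weight (A i) (w i)"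
  shows "locally_finite_weight (PiE I A) (\<lambda>g. \<Sum>i\<in>I. w i (g i)) \<and>
    weight_series (PiE I A) (\<lambda>g. \<Sum>i\<in>I. w i (g i)) (\<lambda>g. \<Prod>i\<in>I. m i (g i))
    = (\<Prod>i\<in>I. weight_series (A i) (w i) (m i))"
  using assms
proof (induction I rule: finite_induct)
  case empty
  \<comment> \<open>The empty product contains a single function, of weight 0, so its series is
    1.\<close>
  have "{x. x = (\<lambda>x. undefined) \<and> t = 0} = (if t = 0 then {\<lambda>x. undefined} else {})" for t :: nat
    by auto
  then show ?case
    by (auto simp: locally_finite_weight_def fps_eq_iff weight_series_nth)
next
  case (insert j I)
  let ?f = "\<lambda>z. (snd z)(j := fst z)"
  let ?W = "\<lambda>g. \<Sum>i\<in>I. w i (g i)" and ?M = "\<lambda>g. \<Prod>i\<in>I. m i (g i)"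
  have bij: "bij_betw ?f (A j \<times> PiE I A) (PiE (insert j I) A)"
    unfolding bij_betw_def
  proof
    show "inj_on ?f (A j \<times> PiE I A)"
      using inj_combinator[OF insert.hyps(2), of A]
      by (simp add: case_prod_unfold)
    show "?f ` (A j \<times> PiE I A) = PiE (insert j I) A"
      by (simp add: PiE_insert_eq case_prod_unfold)
  qed
  have W: "(\<Sum>i\<in>insert j I. w i (?f z i)) = w j (fst z) + ?W (snd z)" for z
    using insert.hyps by (simp, intro sum.cong) auto
  have M: "(\<Prod>i\<in>insert j I. m i (?f z i)) = m j (fst z) * ?M (snd z)" for z
  proof -
    have "(\<Prod>i\<in>I. m i (?f z i)) = ?M (snd z)"
      using insert.hyps by (intro prod.cong) auto
    then show ?thesis using insert.hyps by simp
  qed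
  have IH: "locally_finite_weight (PiE I A) ?W"
      "weight_series (PiE I A) ?W ?M = (\<Prod>i\<in>I. weight_series (A i) (w i) (m i))"
    using insert.IH insert.prems by auto
  have lf: "locally_finite_weight (A j) (w j)" using insert.prems by simp
  show ?case
  proof
    show "locally_finite_weight (PiE (insert j I) A) (\<lambda>g. \<Sum>i\<in>insert j I. w i (g i))"
      using locally_finite_weight_Times[OF lf IH(1)]
      by (rule locally_finite_weight_bij[OF bij, rotated]) (rule W)
    show "weight_series (PiE (insert j I) A) (\<lambda>g. \<Sum>i\<in>insert j I. w i (g i))
        (\<lambda>g. \<Prod>i\<in>insert j I. m i (g i)) = (\<Prod>i\<in>insert j I. weight_series (A i) (w i) (m i))"
    proof (subst weight_series_bij[OF bij])
      show "weight_series (A j \<times> PiE I A) (\<lambda>z. w j (fst z) + ?W (snd z)) (\<lambda>z. m j (fst z) * ?M (snd z))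
          = (\<Prod>i\<in>insert j I. weight_series (A i) (w i) (m i))"
        using weight_series_Times[OF lf IH(1), of "m j" ?M] IH(2) insert.hyps by simp
    qed (rule W M)+
  qed
qed

section \<open>Series of a single integer label\<close>

lemma abs_eq_nat_fiber: "{c::int. nat \<bar>c\<bar> = t} = {int t, - int t}"
  by auto

lemma locally_finite_weight_abs: "locally_finite_weight UNIV (\<lambda>c::int. nat \<bar>c\<bar>)"
  by (simp add: locally_finite_weight_def abs_eq_nat_fiber)

text \<open>One integer has absolute value 0 and two have any given positive one, so the series is
  (1 + z) / (1 - z). All series are stated with the denominator multiplied out.\<close>

lemma weight_series_abs_one:
  "weight_series UNIV (\<lambda>c::int. nat \<bar>c\<bar>) (\<lambda>_. 1) * (1 - fps_X) = 1 + fps_X"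
proof (rule fps_ext)
  fix t
  have "weight_series UNIV (\<lambda>c::int. nat \<bar>c\<bar>) (\<lambda>_. 1) $ s = (if s = 0 then 1 else 2)" for s
    by (simp add: weight_series_nth abs_eq_nat_fiber)
  then show "(weight_series UNIV (\<lambda>c::int. nat \<bar>c\<bar>) (\<lambda>_. 1) * (1 - fps_X)) $ t
      = (1 + fps_X :: int fps) $ t"
    by (auto simp: algebra_simps fps_X_nth)
qed

text \<open>Of s and -s only the nonnegative one counts, with multiplicity s. Multiplying by
  \<open>1 - fps_X\<close> takes differences: the coefficients s become 1 in all positive degrees,
  and a second time only the one in degree 1 remains.\<close>

lemma weight_series_abs_pos:
  "weight_series UNIV (\<lambda>c::int. nat \<bar>c\<bar>) (\<lambda>c. max c 0) * (1 - fps_X)^2 = fps_X"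
proof -
  let ?H = "weight_series UNIV (\<lambda>c::int. nat \<bar>c\<bar>) (\<lambda>c. max c 0)"
  have H: "?H $ s = int s" for s
    by (cases "s = 0") (simp_all add: weight_series_nth abs_eq_nat_fiber)
  have "?H * (1 - fps_X) = Abs_fps (\<lambda>s. if s = 0 then 0 else 1)"
    by (rule fps_ext) (auto simp: algebra_simps H)
  also have "\<dots> * (1 - fps_X) = fps_X"
    by (rule fps_ext) (auto simp: algebra_simps fps_X_nth)
  finally show ?thesis by (simp add: power2_eq_square mult.assoc)
qed

lemma weight_series_nat: "weight_series UNIV (\<lambda>p::nat. p) (\<lambda>_. 1) * (1 - fps_X) = 1"
  by (rule fps_ext) (auto simp: algebra_simps weight_series_nth)

lemma locally_finite_weight_nat: "locally_finite_weight UNIV (\<lambda>p::nat. p)"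
  by (simp add: locally_finite_weight_def)

section \<open>Flow data of a bundle of parallel edges\<close>

definition capacity :: "nat \<Rightarrow> (nat \<Rightarrow> int) \<Rightarrow> int" where
  "capacity m c = (\<Sum>k<m. max (c k) 0)"

definition drain :: "nat \<Rightarrow> (nat \<Rightarrow> int) \<Rightarrow> int" where
  "drain m c = (\<Sum>k<m. max (- c k) 0)"

text \<open>Labels are fixed outside \<open>{..<m}\<close>, so that two labelings are equal as soon
  as they agree on the actual edges and none is counted twice.\<close>

definition edge_labels :: "nat \<Rightarrow> (nat \<Rightarrow> int) set" where
  "edge_labels m = PiE {..<m} (\<lambda>_. UNIV)"

definition label_weight :: "nat \<Rightarrow> (nat \<Rightarrow> int) \<Rightarrow> nat" where
  "label_weight m c = (\<Sum>k<m. nat \<bar>c k\<bar>)"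

lemma capacity_nonneg: "0 \<le> capacity m c"
  by (simp add: capacity_def sum_nonneg)

lemma label_weight_eq: "int (label_weight m c) = capacity m c + drain m c"
  by (simp add: label_weight_def capacity_def drain_def flip: sum.distrib)
    (intro sum.cong, auto)

text \<open>The labels are \<open>m\<close> independent integers. The capacity is a sum over the
  edges, so its series is a sum of \<open>m\<close> equal terms, in each of which one edge carries
  the multiplicity \<open>max c 0\<close> and the others carry 1.\<close>

lemma locally_finite_labels: "locally_finite_weight (edge_labels m) (label_weight m)"
  and label_series_one: "weight_series (edge_labels m) (label_weight m) (\<lambda>_. 1) * (1 - fps_X) ^ m = (1 + fps_X) ^ m"
  and label_series_capacity: "weight_series (edge_labels m) (label_weight m) (capacity m) * (1 - fps_X) ^ (m + 1)
      = of_nat m * fps_X * (1 + fps_X) ^ (m - 1)"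
proof -
  let ?G = "weight_series UNIV (\<lambda>c::int. nat \<bar>c\<bar>) (\<lambda>_. 1)"
  let ?H = "weight_series UNIV (\<lambda>c::int. nat \<bar>c\<bar>) (\<lambda>c. max c 0)"
  have lw: "label_weight m = (\<lambda>c. \<Sum>k<m. nat \<bar>c k\<bar>)"
    by (simp add: label_weight_def fun_eq_iff)
  note P = weight_series_PiE[of "{..<m}" "\<lambda>_. UNIV" "\<lambda>_ (c::int). nat \<bar>c\<bar>",
      OF _ locally_finite_weight_abs, folded edge_labels_def lw, simplified]
  show "locally_finite_weight (edge_labels m) (label_weight m)"
    using P by blast
  have "weight_series (edge_labels m) (label_weight m) (\<lambda>_. 1) = ?G ^ m"
    using conjunct2[OF P[of "\<lambda>_ _. 1"]] by simp
  then show "weight_series (edge_labels m) (label_weight m) (\<lambda>_. 1) * (1 - fps_X) ^ m = (1 + fps_X) ^ m"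
    by (simp add: weight_series_abs_one flip: power_mult_distrib)
  have one: "weight_series (edge_labels m) (label_weight m) (\<lambda>c. max (c j) 0) = ?H * ?G ^ (m - 1)"
    if "j < m" for j
  proof -
    \<comment> \<open>A function of one label is a product over all labels with the other factors 1,
      the form that the product rule handles.\<close>
    have "max (c j) 0 = (\<Prod>k<m. if k = j then max (c k) 0 else 1)" for c :: "nat \<Rightarrow> int"
      using that by (simp add: prod.delta)
    then have "weight_series (edge_labels m) (label_weight m) (\<lambda>c. max (c j) 0)
        = weight_series (edge_labels m) (label_weight m) (\<lambda>c. \<Prod>k<m. if k = j then max (c k) 0 else 1)"
      by simp
    also have "\<dots> = (\<Prod>k<m. weight_series UNIV (\<lambda>c::int. nat \<bar>c\<bar>) (\<lambda>c. if k = j then max c 0 else 1))"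
      using conjunct2[OF P[of "\<lambda>k c. if k = j then max c 0 else 1"]] by simp
    also have "\<dots> = ?H * (\<Prod>k\<in>{..<m}-{j}. ?G)"
      using that by (subst prod.remove[of _ j]) (auto intro!: prod.cong)
    finally show ?thesis using that by simp
  qed
  have "weight_series (edge_labels m) (label_weight m) (capacity m)
      = (\<Sum>j<m. weight_series (edge_labels m) (label_weight m) (\<lambda>c. max (c j) 0))"
    unfolding weight_series_sum[symmetric] by (simp add: capacity_def[abs_def])
  also have "\<dots> = of_nat m * (?H * ?G ^ (m - 1))" using one by simp
  finally have eq: "weight_series (edge_labels m) (label_weight m) (capacity m) = of_nat m * (?H * ?G ^ (m - 1))" .
  show "weight_series (edge_labels m) (label_weight m) (capacity m) * (1 - fps_X) ^ (m + 1)
      = of_nat m * fps_X * (1 + fps_X) ^ (m - 1)"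
  \<comment> \<open>For \<open>m = 0\<close> both sides vanish. Otherwise the exponent is
    \<open>q + 2\<close>: two factors clear the denominator of \<open>?H\<close> and one clears that
    of each of the \<open>q\<close> copies of \<open>?G\<close>.\<close>
  proof (cases m)
    case (Suc q)
    have "of_nat m * (?H * ?G ^ q) * y ^ (q + 2)
        = of_nat m * ((?H * y^2) * (?G * y) ^ q)" for y :: "int fps"
      by (simp add: power_add power_mult_distrib power2_eq_square mult_ac)
    from this[of "1 - fps_X"] show ?thesis unfolding eq
      by (simp only: weight_series_abs_pos weight_series_abs_one)
        (simp add: Suc weight_series_abs_pos weight_series_abs_one mult.assoc)
  qed (use eq in simp)
qed

section \<open>Triples of labels, flow and leftover at one position\<close>

definition flow_data :: "nat \<Rightarrow> ((nat \<Rightarrow> int) \<times> int \<times> nat) set" where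
  "flow_data m = {(c, y, p). c \<in> edge_labels m \<and> \<bar>y\<bar> \<le> capacity m c \<and> (p = 0 \<or> y = capacity m c)}"

definition unsaturated_data :: "nat \<Rightarrow> ((nat \<Rightarrow> int) \<times> int \<times> nat) set" where
  "unsaturated_data m = {(c, y, p) \<in> flow_data m. y < capacity m c}"

definition data_weight :: "nat \<Rightarrow> (nat \<Rightarrow> int) \<times> int \<times> nat \<Rightarrow> nat" where
  "data_weight m = (\<lambda>(c, y, p). label_weight m c + p)"

text \<open>Below the capacity C the leftover must be 0, so for given labels only the flow is free,
  with the 2C values from -C to C - 1. The series is therefore twice that of the capacity.\<close>

lemma locally_finite_unsaturated: "locally_finite_weight (unsaturated_data m) (data_weight m)"
  and unsaturated_series:
    "weight_series (unsaturated_data m) (data_weight m) (\<lambda>_. 1) * (1 - fps_X) ^ (m + 1)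
      = 2 * of_nat m * fps_X * (1 + fps_X) ^ (m - 1)"
proof -
  let ?Y = "\<lambda>c. {- capacity m c..<capacity m c}"
  let ?f = "\<lambda>(c, y). (c, y, 0::nat)"
  have bij: "bij_betw ?f (Sigma (edge_labels m) ?Y) (unsaturated_data m)"
    by (rule bij_betwI[of _ _ _ "\<lambda>(c, y, p). (c, y)"])
      (auto simp: unsaturated_data_def flow_data_def)
  have w: "data_weight m (?f z) = label_weight m (fst z)" for z
    by (simp add: data_weight_def case_prod_unfold)
  have "locally_finite_weight (Sigma (edge_labels m) ?Y) (\<lambda>z. label_weight m (fst z))"
    unfolding locally_finite_weight_def
  proof
    fix t
    have "{z \<in> Sigma (edge_labels m) ?Y. label_weight m (fst z) = t}
        = Sigma {c \<in> edge_labels m. label_weight m c = t} ?Y" by auto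
    then show "finite {z \<in> Sigma (edge_labels m) ?Y. label_weight m (fst z) = t}"
      using locally_finite_labels[of m] by (auto simp: locally_finite_weight_def)
  qed
  then show "locally_finite_weight (unsaturated_data m) (data_weight m)"
    by (rule locally_finite_weight_bij[OF bij, rotated]) (rule w)
  have "weight_series (unsaturated_data m) (data_weight m) (\<lambda>_. 1)
      = weight_series (Sigma (edge_labels m) ?Y) (\<lambda>z. label_weight m (fst z)) (\<lambda>_. 1)"
    by (rule weight_series_bij[OF bij]) (simp_all add: w)
  also have "\<dots> = weight_series (edge_labels m) (label_weight m) (\<lambda>c. int (card (?Y c)))"
    by (rule weight_series_Sigma[OF locally_finite_labels]) simp
  also have "\<dots> = weight_series (edge_labels m) (label_weight m) (\<lambda>c. of_nat 2 * capacity m c)"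
    by (simp add: capacity_nonneg)
  also have "\<dots> = 2 * weight_series (edge_labels m) (label_weight m) (capacity m)"
    unfolding weight_series_scale by simp
  finally show "weight_series (unsaturated_data m) (data_weight m) (\<lambda>_. 1) * (1 - fps_X) ^ (m + 1)
      = 2 * of_nat m * fps_X * (1 + fps_X) ^ (m - 1)"
    using label_series_capacity[of m] by (simp add: mult.assoc)
qed

text \<open>The remaining triples have flow equal to the capacity and an arbitrary leftover. They
  amount to pairs of labels and a natural number, and the latter contributes the factor 1 / (1 -
  z).\<close>

lemma locally_finite_flow: "locally_finite_weight (flow_data m) (data_weight m)"
  and flow_series:
    "weight_series (flow_data m) (data_weight m) (\<lambda>_. 1) * (1 - fps_X) ^ (m + 1)
      = (1 + fps_X) ^ m + 2 * of_nat m * fps_X * (1 + fps_X) ^ (m - 1)"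
proof -
  let ?S = "{(c, y, p). c \<in> edge_labels m \<and> y = capacity m c}"
  let ?f = "\<lambda>(c, p). (c, capacity m c, p)"
  have bij: "bij_betw ?f (edge_labels m \<times> UNIV) ?S"
    by (rule bij_betwI[of _ _ _ "\<lambda>(c, y, p). (c, p)"]) auto
  have w: "data_weight m (?f z) = label_weight m (fst z) + snd z" for z
    by (simp add: data_weight_def case_prod_unfold)
  note lfT = locally_finite_weight_Times[OF locally_finite_labels locally_finite_weight_nat]
  have lfS: "locally_finite_weight ?S (data_weight m)"
    using lfT by (rule locally_finite_weight_bij[OF bij, rotated]) (rule w)
  have split: "flow_data m = unsaturated_data m \<union> ?S" "unsaturated_data m \<inter> ?S = {}"
    using capacity_nonneg[of m] by (auto simp: unsaturated_data_def flow_data_def)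
  show "locally_finite_weight (flow_data m) (data_weight m)"
    unfolding split(1) by (rule locally_finite_weight_Un[OF locally_finite_unsaturated lfS])
  have S: "weight_series ?S (data_weight m) (\<lambda>_. 1)
      = weight_series (edge_labels m) (label_weight m) (\<lambda>_. 1) * weight_series UNIV (\<lambda>p::nat. p) (\<lambda>_. 1)"
    using weight_series_bij[OF bij, of "data_weight m" "\<lambda>z. label_weight m (fst z) + snd z" "\<lambda>_. 1" "\<lambda>_. 1"] w
      weight_series_Times[OF locally_finite_labels locally_finite_weight_nat, of m "\<lambda>_. 1" "\<lambda>_. 1"]
    by simp
  have "weight_series ?S (data_weight m) (\<lambda>_. 1) * (1 - fps_X) ^ (m + 1)
     = (weight_series (edge_labels m) (label_weight m) (\<lambda>_. 1) * (1 - fps_X) ^ m)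
       * (weight_series UNIV (\<lambda>p::nat. p) (\<lambda>_. 1) * (1 - fps_X))"
    unfolding S by (simp add: mult_ac)
  also have "\<dots> = (1 + fps_X) ^ m" by (simp add: label_series_one weight_series_nat)
  finally show "weight_series (flow_data m) (data_weight m) (\<lambda>_. 1) * (1 - fps_X) ^ (m + 1)
      = (1 + fps_X) ^ m + 2 * of_nat m * fps_X * (1 + fps_X) ^ (m - 1)"
    unfolding split(1)
    using weight_series_Un_disjoint[OF locally_finite_unsaturated lfS split(2), of "\<lambda>_. 1"]
      unsaturated_series[of m]
    by (simp add: distrib_right add.commute)
qed

text \<open>Subtracting the excluded choices subtracts their series, and both series are products
  over the positions. Position \<open>i\<close> supplies \<open>a i + 1\<close> factors of the
  denominator; \<open>affine_dim_gens\<close> matches their total with the dimension.\<close>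

lemma flow_minus_unsaturated_series:
  assumes "finite I"
  shows "weight_series (PiE I (\<lambda>i. flow_data (a i)) - PiE I (\<lambda>i. unsaturated_data (a i)))
      (\<lambda>g. \<Sum>i\<in>I. data_weight (a i) (g i)) (\<lambda>_. 1) * (1 - fps_X) ^ (\<Sum>i\<in>I. a i + 1)
    = (\<Prod>i\<in>I. (1 + fps_X) ^ a i + 2 * of_nat (a i) * fps_X * (1 + fps_X) ^ (a i - 1))
    - (\<Prod>i\<in>I. 2 * of_nat (a i) * fps_X * (1 + fps_X) ^ (a i - 1))"
proof -
  let ?F = "PiE I (\<lambda>i. flow_data (a i))" and ?U = "PiE I (\<lambda>i. unsaturated_data (a i))"
  let ?w = "\<lambda>g. \<Sum>i\<in>I. data_weight (a i) (g i)"
  have F: "locally_finite_weight ?F ?w"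
    "weight_series ?F ?w (\<lambda>_. 1) = (\<Prod>i\<in>I. weight_series (flow_data (a i)) (data_weight (a i)) (\<lambda>_. 1))"
    using weight_series_PiE[OF assms locally_finite_flow, of a "\<lambda>_ _. 1"] by auto
  have U: "locally_finite_weight ?U ?w"
    "weight_series ?U ?w (\<lambda>_. 1) = (\<Prod>i\<in>I. weight_series (unsaturated_data (a i)) (data_weight (a i)) (\<lambda>_. 1))"
    using weight_series_PiE[OF assms locally_finite_unsaturated, of a "\<lambda>_ _. 1"] by auto
  have "?U \<subseteq> ?F" by (rule PiE_mono) (auto simp: unsaturated_data_def)
  then have "(?F - ?U) \<union> ?U = ?F" by blast
  then have "weight_series ?F ?w (\<lambda>_. 1) = weight_series (?F - ?U) ?w (\<lambda>_. 1) + weight_series ?U ?w (\<lambda>_. 1)"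
    using weight_series_Un_disjoint[OF locally_finite_weight_subset[OF F(1), of "?F - ?U"] U(1), of "\<lambda>_. 1"]
    by auto
  then have "weight_series (?F - ?U) ?w (\<lambda>_. 1) * (1 - fps_X) ^ (\<Sum>i\<in>I. a i + 1)
    = weight_series ?F ?w (\<lambda>_. 1) * (\<Prod>i\<in>I. (1 - fps_X) ^ (a i + 1))
     - weight_series ?U ?w (\<lambda>_. 1) * (\<Prod>i\<in>I. (1 - fps_X) ^ (a i + 1))"
    by (simp only: power_sum left_diff_distrib) (simp add: algebra_simps)
  then show ?thesis
    unfolding F(2) U(2) prod.distrib[symmetric] flow_series unsaturated_series .
qed

lemma capacity_cong: "(\<And>k. k < m \<Longrightarrow> c k = c' k) \<Longrightarrow> capacity m c = capacity m c'"
  and drain_cong: "(\<And>k. k < m \<Longrightarrow> c k = c' k) \<Longrightarrow> drain m c = drain m c'"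
  by (simp_all add: capacity_def drain_def)

lemma capacity_of_int: "real_of_int (capacity m c) = (\<Sum>k<m. max (real_of_int (c k)) 0)"
  by (simp add: capacity_def of_int_max)

lemma drain_of_int: "real_of_int (drain m c) = (\<Sum>k<m. max (- real_of_int (c k)) 0)"
  by (simp add: drain_def of_int_max)

lemma capacity_minus_drain: "capacity m c - drain m c = (\<Sum>k<m. c k)"
  unfolding capacity_def drain_def sum_subtractf[symmetric] by (intro sum.cong) auto

section \<open>Dimension\<close>

lemma lookup_scaleR:
  "Poly_Mapping.lookup (r *\<^sub>R x) k = r *\<^sub>R Poly_Mapping.lookup x k"
proof -
  have "finite {i. r *\<^sub>R Poly_Mapping.lookup x i \<noteq> 0}"
    by (rule finite_subset[OF _ finite_lookup[of x]]) auto
  then show ?thesis by (simp add: scaleR_poly_mapping_def)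
qed

text \<open>The set lies in the hyperplane of coordinate sum 1 and contains all unit vectors, so the
  vectors from one of them, \<open>k0\<close>, to the others form a basis of its direction
  space.\<close>

lemma affine_dim_eq:
  fixes P :: "('k \<Rightarrow>\<^sub>0 real) set"
  assumes fin: "finite I" and ne: "I \<noteq> {}"
    and unit: "\<And>k. k \<in> I \<Longrightarrow> unit_vec k \<in> P"
    and supp: "\<And>x k. x \<in> P \<Longrightarrow> k \<notin> I \<Longrightarrow> Poly_Mapping.lookup x k = 0"
    and total: "\<And>x. x \<in> P \<Longrightarrow> (\<Sum>k\<in>I. Poly_Mapping.lookup x k) = 1"
  shows "affine_dim P = card I - 1"
proof -
  from ne obtain k0 where k0: "k0 \<in> I" by blast
  let ?b = "\<lambda>k. unit_vec k - unit_vec k0 :: 'k \<Rightarrow>\<^sub>0 real"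
  let ?B = "?b ` (I - {k0})"
  let ?D = "{x - y | x y. x \<in> P \<and> y \<in> P}"
  have lb: "Poly_Mapping.lookup (?b k) j = (if j = k then 1 else 0) - (if j = k0 then 1 else 0)" for j k
    by (simp add: lookup_minus lookup_single)
  have inj: "inj_on ?b (I - {k0})"
  proof (rule inj_onI)
    fix k j assume k: "k \<in> I - {k0}" "j \<in> I - {k0}" and eq: "?b k = ?b j"
    have "Poly_Mapping.lookup (?b k) k = Poly_Mapping.lookup (?b j) k" by (simp only: eq)
    then show "k = j" using k unfolding lb by (auto split: if_splits)
  qed
  have "?B \<subseteq> ?D" using unit k0 by blast
  moreover have "?D \<subseteq> span ?B"
  proof clarify
    fix x y assume xy: "x \<in> P" "y \<in> P"
    let ?r = "\<lambda>k. Poly_Mapping.lookup (x - y) k"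
    have r: "(\<Sum>k\<in>I. ?r k) = 0"
      using total xy by (simp add: lookup_minus sum_subtractf)
    \<comment> \<open>The coordinate at \<open>k0\<close> comes out right because the coordinates of
      \<open>x - y\<close> sum to 0.\<close>
    have "x - y = (\<Sum>k\<in>I - {k0}. ?r k *\<^sub>R ?b k)"
    proof (rule poly_mapping_eqI)
      fix j
      have "Poly_Mapping.lookup (\<Sum>k\<in>I - {k0}. ?r k *\<^sub>R ?b k) j
          = (\<Sum>k\<in>I - {k0}. ?r k * ((if j = k then 1 else 0) - (if j = k0 then 1 else 0)))"
        by (simp only: lookup_sum lookup_scaleR lb real_scaleR_def)
      also have "\<dots> = ?r j"
      proof (cases "j = k0")
        case True
        then have "(\<Sum>k\<in>I - {k0}. ?r k * ((if j = k then 1 else 0) - (if j = k0 then 1 else 0)))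
            = (\<Sum>k\<in>I - {k0}. - ?r k)" by (intro sum.cong) auto
        also have "\<dots> = ?r k0"
          using r sum.remove[OF fin k0, of ?r] by (simp only: sum_negf)
        finally show ?thesis using True by simp
      next
        case False
        then have "(\<Sum>k\<in>I - {k0}. ?r k * ((if j = k then 1 else 0) - (if j = k0 then 1 else 0)))
            = (\<Sum>k\<in>I - {k0}. if j = k then ?r k else 0)" by (intro sum.cong) auto
        also have "\<dots> = ?r j"
          using False fin supp[OF xy(1), of j] supp[OF xy(2), of j]
          by (simp add: sum.delta' lookup_minus)
        finally show ?thesis .
      qed
      finally show "?r j = Poly_Mapping.lookup (\<Sum>k\<in>I - {k0}. ?r k *\<^sub>R ?b k) j" ..
    qed
    also have "\<dots> \<in> span ?B"
      by (intro real_vector.span_sum real_vector.span_scale real_vector.span_base) auto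
    finally show "x - y \<in> span ?B" .
  qed
  moreover have "independent ?B"
  proof (rule real_vector.independent_if_scalars_zero)
    show "finite ?B" using fin by simp
    fix u x assume z: "(\<Sum>x\<in>?B. u x *\<^sub>R x) = 0" and "x \<in> ?B"
    then obtain k where k: "k \<in> I - {k0}" "x = ?b k" by blast
    have "(\<Sum>j\<in>I - {k0}. u (?b j) *\<^sub>R ?b j) = 0"
      using z by (simp add: sum.reindex[OF inj])
    \<comment> \<open>In the coordinate \<open>k\<close> only the vector \<open>?b k\<close> is
      nonzero, since \<open>k\<close> differs from \<open>k0\<close>.\<close>
    then have "Poly_Mapping.lookup (\<Sum>j\<in>I - {k0}. u (?b j) *\<^sub>R ?b j) k = 0" by simp
    then have "(\<Sum>j\<in>I - {k0}. u (?b j) * ((if k = j then 1 else 0) - (if k = k0 then 1 else 0))) = 0"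
      by (simp only: lookup_sum lookup_scaleR lb real_scaleR_def)
    moreover have "(\<Sum>j\<in>I - {k0}. u (?b j) * ((if k = j then 1 else 0) - (if k = k0 then 1 else 0)))
        = (\<Sum>j\<in>I - {k0}. if k = j then u (?b j) else 0)"
      using k by (intro sum.cong) auto
    ultimately have "(\<Sum>j\<in>I - {k0}. if k = j then u (?b j) else 0) = 0" by (simp only:)
    then have "u (?b k) = 0" using k(1) fin by (subst (asm) sum.delta') auto
    then show "u x = 0" by (simp only: k(2))
  qed
  moreover have "card ?B = card I - 1"
    using card_image[OF inj] k0 fin by simp
  ultimately show ?thesis
    unfolding affine_dim_def by (rule real_vector.dim_unique)
qed

section \<open>Flows on the multicycle\<close>

locale multicycle_polytope =
  fixes n :: nat and a :: "nat \<Rightarrow> nat"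
  assumes n_ge_2: "n \<ge> 2" and a_pos: "\<And>i. i \<in> {1..n} \<Longrightarrow> a i \<ge> 1"
begin

definition nxt :: "nat \<Rightarrow> nat" where "nxt i = i mod n + 1"

definition prv :: "nat \<Rightarrow> nat" where "prv i = (if i = 1 then n else i - 1)"

definition V :: "nat set" where "V = {1..n}"

lemma finite_V [simp]: "finite V" and card_V: "card V = n" and V_iff: "i \<in> V \<longleftrightarrow> 1 \<le> i \<and> i \<le> n"
  by (simp_all add: V_def)

abbreviation E :: "(nat \<times> nat) set" where "E \<equiv> (SIGMA i:V. {..<a i})"

definition coords :: "(nat + nat \<times> nat) set" where "coords = Inl ` V \<union> Inr ` E"

lemma nxt_eq: "i \<in> V \<Longrightarrow> nxt i = (if i = n then 1 else i + 1)"
  by (auto simp: nxt_def V_iff)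

lemma nxt_in [simp]: "i \<in> V \<Longrightarrow> nxt i \<in> V"
  by (auto simp: nxt_eq V_iff)

lemma prv_in [simp]: "i \<in> V \<Longrightarrow> prv i \<in> V"
  by (auto simp: prv_def V_iff)

lemma nxt_prv [simp]:
  assumes "i \<in> V" shows "nxt (prv i) = i"
  using nxt_eq[OF prv_in[OF assms]] assms by (auto simp: prv_def V_iff)

lemma prv_nxt [simp]: "i \<in> V \<Longrightarrow> prv (nxt i) = i"
  by (auto simp: nxt_eq prv_def V_iff)

lemma prv_eq_iff: "i \<in> V \<Longrightarrow> j \<in> V \<Longrightarrow> prv i = j \<longleftrightarrow> i = nxt j"
  by auto

text \<open>As \<open>prv\<close> permutes the vertices, flows cancel when vertex coordinates are
  summed around the cycle.\<close>

lemma sum_prv: "(\<Sum>i\<in>V. h (prv i)) = (\<Sum>i\<in>V. h i)"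
  by (rule sum.reindex_bij_witness[of _ nxt prv]) auto

text \<open>Climb from the starting vertex to \<open>n\<close>, step across to 1, and climb again to
  reach every vertex.\<close>

lemma cyclic_induct:
  assumes "i \<in> V" "Q i" "\<And>i. i \<in> V \<Longrightarrow> Q (prv i) \<Longrightarrow> Q i" "j \<in> V"
  shows "Q j"
proof -
  have up: "Q k" if "Q l" "l \<in> V" "l \<le> k" "k \<le> n" for k l
    using that(3,1,2,4)
  proof (induction k rule: dec_induct)
    case (step k)
    then have "prv (Suc k) = k" "Suc k \<in> V" by (auto simp: prv_def V_iff)
    with step show ?case using assms(3)[of "Suc k"] by (auto simp: V_iff)
  qed
  have "Q n" using up[of i n] assms(1,2) by (auto simp: V_iff)
  then have "Q 1" using assms(3)[of 1] n_ge_2 by (auto simp: prv_def V_iff)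
  then show "Q j" using up[of 1 j] assms(4) n_ge_2 by (auto simp: V_iff)
qed

text \<open>A flow of this kind is the largest admissible one, hence unique. Going around from a
  saturated vertex: if \<open>p i = 0\<close>, the bound on \<open>y'\<close> at \<open>i\<close>
  passes the comparison on from \<open>prv i\<close> to \<open>i\<close>; otherwise
  \<open>y i\<close> is the capacity and cannot be exceeded.\<close>

lemma saturated_flow_le:
  fixes b p y y' C :: "nat \<Rightarrow> int"
  assumes b: "\<And>i. i \<in> V \<Longrightarrow> b i = p i + y i - y (prv i)"
    and p: "\<And>i. i \<in> V \<Longrightarrow> p i = 0 \<or> y i = C i"
    and sat: "i \<in> V" "y i = C i"
    and y': "\<And>i. i \<in> V \<Longrightarrow> y' i \<le> C i" "\<And>i. i \<in> V \<Longrightarrow> y' i - y' (prv i) \<le> b i"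
    and "j \<in> V"
  shows "y' j \<le> y j"
proof (rule cyclic_induct[OF sat(1), where Q = "\<lambda>j. y' j \<le> y j"])
  show "y' i \<le> y i" using sat y'(1) by simp
  fix i assume i: "i \<in> V" and "y' (prv i) \<le> y (prv i)"
  then show "y' i \<le> y i" using b[OF i] p[OF i] y'(1)[OF i] y'(2)[OF i] by auto
qed fact

lemma ex_saturated_flow:
  fixes b C :: "nat \<Rightarrow> int"
  assumes ex: "\<exists>y. \<forall>i\<in>V. \<bar>y i\<bar> \<le> C i \<and> y i - y (prv i) \<le> b i"
  shows "\<exists>y. (\<forall>i\<in>V. \<bar>y i\<bar> \<le> C i \<and> y i - y (prv i) \<le> b i \<and> (b i = y i - y (prv i) \<or> y i = C i))
    \<and> (\<exists>i\<in>V. y i = C i)"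
proof -
  \<comment> \<open>An admissible flow of maximal sum works: otherwise one value, or all values, could be raised by 1.\<close>
  define adm where "adm y \<longleftrightarrow> (\<forall>i\<in>V. \<bar>y i\<bar> \<le> C i \<and> y i - y (prv i) \<le> b i)" for y
  \<comment> \<open>Adding \<open>C i\<close> makes the sum nonnegative, so \<open>nat\<close> loses
    nothing and a maximum over a bounded natural-valued function can be taken.\<close>
  define size where "size y = nat (\<Sum>i\<in>V. y i + C i)" for y
  have size: "int (size y) = (\<Sum>i\<in>V. y i) + (\<Sum>i\<in>V. C i)" if "adm y" for y
  proof -
    have "0 \<le> y i + C i" if "i \<in> V" for i
      using \<open>adm y\<close> that by (force simp: adm_def)
    then have "0 \<le> (\<Sum>i\<in>V. y i + C i)" by (intro sum_nonneg) auto
    then show ?thesis by (simp add: size_def sum.distrib)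
  qed
  have bound: "size y \<le> nat (\<Sum>i\<in>V. 2 * C i)" if "adm y" for y
    unfolding size_def
  proof (intro nat_mono sum_mono)
    fix i assume "i \<in> V"
    then have "\<bar>y i\<bar> \<le> C i" using that by (simp add: adm_def)
    then show "y i + C i \<le> 2 * C i" by linarith
  qed
  obtain y0 where "adm y0" using ex by (auto simp: adm_def)
  then obtain y where y: "adm y" and max: "\<And>y'. adm y' \<Longrightarrow> size y' \<le> size y"
    using ex_has_greatest_nat[of adm y0 size "Suc (nat (\<Sum>i\<in>V. 2 * C i))"] bound by (auto simp: less_Suc_eq_le)
  have max': "(\<Sum>i\<in>V. y' i) \<le> (\<Sum>i\<in>V. y i)" if "adm y'" for y'
    using size[OF that] size[OF y] max[OF that] by linarith
  have tight: "b i = y i - y (prv i) \<or> y i = C i" if i: "i \<in> V" for i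
  proof (rule ccontr)
    assume neg: "\<not> ?thesis"
    let ?y = "y(i := y i + 1)"
    have yi: "\<bar>y i\<bar> \<le> C i" "y i - y (prv i) \<le> b i" using y i by (auto simp: adm_def)
    \<comment> \<open>Raising \<open>y i\<close> only relaxes the constraint at
      \<open>nxt i\<close>. At \<open>i\<close> itself both upper bounds are strict, and so leave
      room for 1.\<close>
    have "adm ?y"
      unfolding adm_def
    proof
      fix j assume j: "j \<in> V"
      then have "\<bar>y j\<bar> \<le> C j" "y j - y (prv j) \<le> b j" using y by (auto simp: adm_def)
      then show "\<bar>?y j\<bar> \<le> C j \<and> ?y j - ?y (prv j) \<le> b j"
        using yi neg by auto
    qed
    moreover have "(\<Sum>j\<in>V. ?y j) = (\<Sum>j\<in>V. y j) + 1"
    proof -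
      have "(\<Sum>j\<in>V - {i}. ?y j) = (\<Sum>j\<in>V - {i}. y j)" by (intro sum.cong) auto
      then show ?thesis using sum.remove[of V i ?y] sum.remove[of V i y] i by simp
    qed
    ultimately show False using max'[of ?y] by simp
  qed
  moreover have "\<exists>i\<in>V. y i = C i"
  proof (rule ccontr)
    assume "\<not> ?thesis"
    then have lt: "y i \<noteq> C i" if "i \<in> V" for i using that by blast
    \<comment> \<open>A common shift leaves all differences \<open>y i - y (prv i)\<close>
      unchanged, so only the capacities matter.\<close>
    have "adm (\<lambda>i. y i + 1)"
      unfolding adm_def
    proof
      fix i assume i: "i \<in> V"
      then have "\<bar>y i\<bar> \<le> C i" "y i - y (prv i) \<le> b i" using y by (auto simp: adm_def)
      then show "\<bar>y i + 1\<bar> \<le> C i \<and> y i + 1 - (y (prv i) + 1) \<le> b i" using lt[OF i] by linarith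
    qed
    moreover have "(\<Sum>i\<in>V. y i + 1) = (\<Sum>i\<in>V. y i) + int n"
      by (simp add: sum.distrib card_V)
    ultimately show False using max'[of "\<lambda>i. y i + 1"] n_ge_2 by simp
  qed
  ultimately show ?thesis using y unfolding adm_def by blast
qed

section \<open>Membership in the dilated polytope\<close>

definition edge_vec :: "nat \<times> nat \<Rightarrow> real \<Rightarrow> real \<Rightarrow> real \<Rightarrow> (nat + nat \<times> nat \<Rightarrow>\<^sub>0 real)" where
  "edge_vec f \<alpha> \<beta> \<gamma> = Poly_Mapping.single (Inl (fst f)) \<alpha>
     + Poly_Mapping.single (Inl (nxt (fst f))) \<beta> + Poly_Mapping.single (Inr f) \<gamma>"

lemma lookup_edge_vec:
  "Poly_Mapping.lookup (edge_vec f \<alpha> \<beta> \<gamma>) (Inl i) = (if i = fst f then \<alpha> else 0) + (if i = nxt (fst f) then \<beta> else 0)"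
  "Poly_Mapping.lookup (edge_vec f \<alpha> \<beta> \<gamma>) (Inr e) = (if e = f then \<gamma> else 0)"
  by (auto simp: edge_vec_def lookup_add lookup_single when_def)

definition gens :: "(nat + nat \<times> nat \<Rightarrow>\<^sub>0 real) set" where
  "gens = (\<Union>f\<in>E. {edge_vec f 1 1 (-1), edge_vec f 1 (-1) 1, edge_vec f (-1) 1 1})"

lemma cosmological_polytope_multicycle:
  "cosmological_polytope (multicycle n a) = convex hull gens"
proof -
  have gen: "unit_vec (Inl i) + unit_vec (Inl j) - unit_vec (Inr f) = edge_vec f 1 1 (-1)"
    "unit_vec (Inl i) - unit_vec (Inl j) + unit_vec (Inr f) = edge_vec f 1 (-1) 1"
    "- unit_vec (Inl i) + unit_vec (Inl j) + unit_vec (Inr f) = edge_vec f (-1) 1 1"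
    if "i = fst f" "j = nxt (fst f)" for i j and f :: "nat \<times> nat"
    using that by (simp_all add: edge_vec_def single_uminus)
  \<comment> \<open>With the endpoints in the opposite order the second and third generators trade
    places.\<close>
  have gen': "unit_vec (Inl i) + unit_vec (Inl j) - unit_vec (Inr f) = edge_vec f 1 1 (-1)"
    "unit_vec (Inl i) - unit_vec (Inl j) + unit_vec (Inr f) = edge_vec f (-1) 1 1"
    "- unit_vec (Inl i) + unit_vec (Inl j) + unit_vec (Inr f) = edge_vec f 1 (-1) 1"
    if "j = fst f" "i = nxt (fst f)" for i j and f :: "nat \<times> nat"
    using that by (simp_all add: edge_vec_def single_uminus)
  let ?S = "\<lambda>i j f. {unit_vec (Inl i) + unit_vec (Inl j) - unit_vec (Inr f),
      unit_vec (Inl i) - unit_vec (Inl j) + unit_vec (Inr f),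
      - unit_vec (Inl i) + unit_vec (Inl j) + unit_vec (Inr f)} :: (nat + nat \<times> nat \<Rightarrow>\<^sub>0 real) set"
  let ?T = "\<lambda>f. {edge_vec f 1 1 (-1), edge_vec f 1 (-1) 1, edge_vec f (-1) 1 1}"
  have ends: "ends (multicycle n a) f = {fst f, nxt (fst f)}" and edges: "edges (multicycle n a) = E" for f
    by (simp_all add: multicycle_def nxt_def V_def case_prod_unfold)
  have "?S i j f = ?T f" if "ends (multicycle n a) f = {i, j}" for i j f
  proof -
    have "(i = fst f \<and> j = nxt (fst f)) \<or> (j = fst f \<and> i = nxt (fst f))"
      using that unfolding ends by (auto simp: doubleton_eq_iff)
    then show ?thesis
    proof
      assume "i = fst f \<and> j = nxt (fst f)"
      then show ?thesis by (simp only: gen)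
    next
      assume "j = fst f \<and> i = nxt (fst f)"
      then show ?thesis by (simp only: gen') auto
    qed
  qed
  then have ST: "\<And>i j f. ends (multicycle n a) f = {i, j} \<Longrightarrow> ?S i j f = ?T f" .
  have "{?S i j f | i j f. f \<in> edges (multicycle n a) \<and> ends (multicycle n a) f = {i, j}} = ?T ` E"
    (is "?L = _")
  proof (intro equalityI subsetI)
    fix A assume "A \<in> ?L"
    then show "A \<in> ?T ` E" unfolding edges using ST by blast
  next
    fix A assume "A \<in> ?T ` E"
    then obtain f where f: "f \<in> E" "A = ?T f" by blast
    have "A = ?S (fst f) (nxt (fst f)) f" unfolding f(2) by (simp only: gen)
    then show "A \<in> ?L" unfolding edges using f(1) ends[of f] by blast
  qed
  then show ?thesis unfolding cosmological_polytope_def gens_def by simp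
qed

text \<open>This linear functional is 1 on all generators, so on the cone over the polytope it reads
  off the dilation factor.\<close>

definition total :: "(nat + nat \<times> nat \<Rightarrow>\<^sub>0 real) \<Rightarrow> real" where
  "total x = (\<Sum>k\<in>coords. Poly_Mapping.lookup x k)"

lemma finite_coords: "finite coords"
  by (simp add: coords_def)

lemma Inl_coords [simp]: "Inl i \<in> coords \<longleftrightarrow> i \<in> V"
  and Inr_coords [simp]: "Inr f \<in> coords \<longleftrightarrow> f \<in> E"
  by (auto simp: coords_def)

lemma sum_coords: "(\<Sum>k\<in>coords. h k) = (\<Sum>i\<in>V. h (Inl i)) + (\<Sum>i\<in>V. \<Sum>k<a i. h (Inr (i, k)))"
proof -
  have "(\<Sum>k\<in>coords. h k) = (\<Sum>k\<in>Inl ` V. h k) + (\<Sum>k\<in>Inr ` E. h k)"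
    unfolding coords_def by (rule sum.union_disjoint) auto
  then show ?thesis by (simp add: sum.reindex sum.Sigma case_prod_unfold)
qed

lemma total_simps:
  "total (x + y) = total x + total y" "total (s *\<^sub>R x) = s * total x"
  "k \<in> coords \<Longrightarrow> total (Poly_Mapping.single k r) = r"
  by (simp_all only: total_def lookup_add lookup_scaleR sum.distrib sum_distrib_left
      lookup_single when_def sum.delta' finite_coords real_scaleR_def if_True)

lemma total_gens: "x \<in> gens \<Longrightarrow> total x = 1"
  by (auto simp: gens_def edge_vec_def total_simps)

lemma total_polytope: "x \<in> convex hull gens \<Longrightarrow> total x = 1"
proof -
  have "convex {x. total x = 1}" unfolding convex_def by (simp add: total_simps algebra_simps)
  then have "convex hull gens \<subseteq> {x. total x = 1}"
    by (intro hull_minimal) (auto simp: total_gens)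
  then show "x \<in> convex hull gens \<Longrightarrow> total x = 1" by blast
qed

section \<open>Splitting a vector into contributions of the edges\<close>

text \<open>\<open>\<alpha> f\<close> and \<open>\<beta> f\<close> are the parts that the edge \<open>f\<close> contributes to the coordinates of its tail and head.\<close>

definition edge_split :: "(nat + nat \<times> nat \<Rightarrow>\<^sub>0 real) \<Rightarrow> (nat \<times> nat \<Rightarrow> real) \<Rightarrow> (nat \<times> nat \<Rightarrow> real) \<Rightarrow> bool" where
  "edge_split x \<alpha> \<beta> \<longleftrightarrow> (\<forall>k. k \<notin> coords \<longrightarrow> Poly_Mapping.lookup x k = 0)
    \<and> (\<forall>f\<in>E. 0 \<le> \<alpha> f + \<beta> f \<and> 0 \<le> \<alpha> f + Poly_Mapping.lookup x (Inr f) \<and> 0 \<le> \<beta> f + Poly_Mapping.lookup x (Inr f))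
    \<and> (\<forall>i\<in>V. Poly_Mapping.lookup x (Inl i) = (\<Sum>k<a i. \<alpha> (i, k)) + (\<Sum>k<a (prv i). \<beta> (prv i, k)))"

text \<open>The conditions are linear and homogeneous in \<open>x\<close>, \<open>\<alpha>\<close>
  and \<open>\<beta>\<close> together. With \<open>edge_split_add\<close> this makes the vectors
  that admit a split a convex cone.\<close>

lemma edge_split_scale:
  assumes "edge_split x \<alpha> \<beta>" "0 \<le> s"
  shows "edge_split (s *\<^sub>R x) (\<lambda>f. s * \<alpha> f) (\<lambda>f. s * \<beta> f)"
  unfolding edge_split_def
proof (intro conjI ballI allI impI)
  fix f assume f: "f \<in> E"
  let ?\<gamma> = "Poly_Mapping.lookup x (Inr f)"
  have "0 \<le> \<alpha> f + \<beta> f" "0 \<le> \<alpha> f + ?\<gamma>" "0 \<le> \<beta> f + ?\<gamma>"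
    using assms(1) f unfolding edge_split_def by blast+
  from this[THEN mult_nonneg_nonneg[OF assms(2)]]
  show "0 \<le> s * \<alpha> f + s * \<beta> f" "0 \<le> s * \<alpha> f + Poly_Mapping.lookup (s *\<^sub>R x) (Inr f)"
    "0 \<le> s * \<beta> f + Poly_Mapping.lookup (s *\<^sub>R x) (Inr f)"
    by (simp_all only: lookup_scaleR real_scaleR_def distrib_left)
next
  fix k assume "k \<notin> coords"
  then show "Poly_Mapping.lookup (s *\<^sub>R x) k = 0"
    using assms(1) by (simp add: edge_split_def lookup_scaleR)
next
  fix i assume "i \<in> V"
  then have "Poly_Mapping.lookup x (Inl i) = (\<Sum>k<a i. \<alpha> (i, k)) + (\<Sum>k<a (prv i). \<beta> (prv i, k))"
    using assms(1) unfolding edge_split_def by blast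
  then show "Poly_Mapping.lookup (s *\<^sub>R x) (Inl i)
      = (\<Sum>k<a i. s * \<alpha> (i, k)) + (\<Sum>k<a (prv i). s * \<beta> (prv i, k))"
    by (simp only: lookup_scaleR real_scaleR_def distrib_left sum_distrib_left)
qed

lemma edge_split_add:
  assumes "edge_split x \<alpha> \<beta>" "edge_split x' \<alpha>' \<beta>'"
  shows "edge_split (x + x') (\<lambda>f. \<alpha> f + \<alpha>' f) (\<lambda>f. \<beta> f + \<beta>' f)"
  unfolding edge_split_def
proof (intro conjI ballI allI impI)
  fix f assume f: "f \<in> E"
  let ?\<gamma> = "Poly_Mapping.lookup x (Inr f)" and ?\<gamma>' = "Poly_Mapping.lookup x' (Inr f)"
  have "0 \<le> \<alpha> f + \<beta> f" "0 \<le> \<alpha> f + ?\<gamma>" "0 \<le> \<beta> f + ?\<gamma>"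
    "0 \<le> \<alpha>' f + \<beta>' f" "0 \<le> \<alpha>' f + ?\<gamma>'" "0 \<le> \<beta>' f + ?\<gamma>'"
    using assms f unfolding edge_split_def by blast+
  then show "0 \<le> \<alpha> f + \<alpha>' f + (\<beta> f + \<beta>' f)"
    "0 \<le> \<alpha> f + \<alpha>' f + Poly_Mapping.lookup (x + x') (Inr f)"
    "0 \<le> \<beta> f + \<beta>' f + Poly_Mapping.lookup (x + x') (Inr f)"
    unfolding lookup_add by linarith+
next
  fix k assume "k \<notin> coords"
  then show "Poly_Mapping.lookup (x + x') k = 0"
    using assms by (simp add: edge_split_def lookup_add)
next
  fix i assume "i \<in> V"
  then have "Poly_Mapping.lookup x (Inl i) = (\<Sum>k<a i. \<alpha> (i, k)) + (\<Sum>k<a (prv i). \<beta> (prv i, k))"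
    "Poly_Mapping.lookup x' (Inl i) = (\<Sum>k<a i. \<alpha>' (i, k)) + (\<Sum>k<a (prv i). \<beta>' (prv i, k))"
    using assms unfolding edge_split_def by blast+
  then show "Poly_Mapping.lookup (x + x') (Inl i)
      = (\<Sum>k<a i. \<alpha> (i, k) + \<alpha>' (i, k)) + (\<Sum>k<a (prv i). \<beta> (prv i, k) + \<beta>' (prv i, k))"
    by (simp only: lookup_add sum.distrib)
qed

lemma edge_split_edge_vec:
  assumes f: "f \<in> E" and "0 \<le> \<alpha> + \<beta>" "0 \<le> \<alpha> + \<gamma>" "0 \<le> \<beta> + \<gamma>"
  shows "edge_split (edge_vec f \<alpha> \<beta> \<gamma>) (\<lambda>e. if e = f then \<alpha> else 0) (\<lambda>e. if e = f then \<beta> else 0)"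
proof -
  obtain j l where jl: "f = (j, l)" "j \<in> V" "l < a j" using f by auto
  have s: "(\<Sum>k<a i. if (i, k) = f then r else 0) = (if i = j then r else 0)" for i and r :: real
    using jl by (cases "i = j") auto
  have "Poly_Mapping.lookup (edge_vec f \<alpha> \<beta> \<gamma>) k = 0" if "k \<notin> coords" for k
    using that jl nxt_in[OF jl(2)] by (cases k) (auto simp: lookup_edge_vec)
  moreover have "Poly_Mapping.lookup (edge_vec f \<alpha> \<beta> \<gamma>) (Inl i)
      = (if i = j then \<alpha> else 0) + (if prv i = j then \<beta> else 0)" if "i \<in> V" for i
    using that jl by (simp add: lookup_edge_vec prv_eq_iff)
  ultimately show ?thesis
    using assms unfolding edge_split_def s by (simp add: lookup_edge_vec)
qed

lemma edge_split_polytope: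
  assumes "x \<in> convex hull gens"
  shows "\<exists>\<alpha> \<beta>. edge_split x \<alpha> \<beta>"
proof -
  have "\<exists>\<alpha> \<beta>. edge_split x \<alpha> \<beta>" if x: "x \<in> gens" for x
  proof -
    obtain f where f: "f \<in> E" "x \<in> {edge_vec f 1 1 (-1), edge_vec f 1 (-1) 1, edge_vec f (-1) 1 1}"
      using x unfolding gens_def by blast
    then obtain \<alpha> \<beta> \<gamma> where "x = edge_vec f \<alpha> \<beta> \<gamma>" "0 \<le> \<alpha> + \<beta>" "0 \<le> \<alpha> + \<gamma>" "0 \<le> \<beta> + \<gamma>"
      by force
    then show ?thesis using edge_split_edge_vec[OF f(1)] by blast
  qed
  then have "gens \<subseteq> {x. \<exists>\<alpha> \<beta>. edge_split x \<alpha> \<beta>}" by blast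
  moreover have "convex {x. \<exists>\<alpha> \<beta>. edge_split x \<alpha> \<beta>}"
  proof (rule convexI)
    fix x y and u v :: real
    assume "x \<in> {x. \<exists>\<alpha> \<beta>. edge_split x \<alpha> \<beta>}" "y \<in> {x. \<exists>\<alpha> \<beta>. edge_split x \<alpha> \<beta>}" and uv: "0 \<le> u" "0 \<le> v"
    then obtain \<alpha> \<beta> \<alpha>' \<beta>' where "edge_split x \<alpha> \<beta>" "edge_split y \<alpha>' \<beta>'" by blast
    from edge_split_add[OF edge_split_scale[OF this(1) uv(1)] edge_split_scale[OF this(2) uv(2)]]
    show "u *\<^sub>R x + v *\<^sub>R y \<in> {x. \<exists>\<alpha> \<beta>. edge_split x \<alpha> \<beta>}" by blast
  qed
  ultimately have "convex hull gens \<subseteq> {x. \<exists>\<alpha> \<beta>. edge_split x \<alpha> \<beta>}"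
    by (rule hull_minimal)
  then show ?thesis using assms by blast
qed

section \<open>The cone over the polytope\<close>

definition gens_cone :: "(nat + nat \<times> nat \<Rightarrow>\<^sub>0 real) set" where
  "gens_cone = {s *\<^sub>R w | s w. 0 \<le> s \<and> w \<in> convex hull gens}"

text \<open>Unless both multiples vanish, the sum is \<open>s + s'\<close> times a weighted mean of
  the two hull points.\<close>

lemma gens_cone_add:
  assumes "x \<in> gens_cone" "y \<in> gens_cone"
  shows "x + y \<in> gens_cone"
proof -
  obtain s w s' w' where x: "x = s *\<^sub>R w" "0 \<le> s" "w \<in> convex hull gens"
    and y: "y = s' *\<^sub>R w'" "0 \<le> s'" "w' \<in> convex hull gens"
    using assms unfolding gens_cone_def by blast
  show ?thesis
  proof (cases "s + s' = 0")
    case True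
    then have "s = 0" "s' = 0" using x(2) y(2) by auto
    then have "x + y = 0 *\<^sub>R w" using x(1) y(1) by simp
    then show ?thesis unfolding gens_cone_def using x(3) by blast
  next
    case False
    let ?w = "(s / (s + s')) *\<^sub>R w + (s' / (s + s')) *\<^sub>R w'"
    have "?w \<in> convex hull gens"
      using False x y by (intro convexD[OF convex_convex_hull]) (auto simp: add_divide_distrib[symmetric])
    moreover have "x + y = (s + s') *\<^sub>R ?w"
      using False x(1) y(1) by (simp add: scaleR_add_right)
    ultimately show ?thesis unfolding gens_cone_def using x(2) y(2) by (blast intro: add_nonneg_nonneg)
  qed
qed

lemma gens_cone_gen: "x \<in> gens \<Longrightarrow> 0 \<le> s \<Longrightarrow> s *\<^sub>R x \<in> gens_cone"
  unfolding gens_cone_def using hull_inc[of x gens convex] by blast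

lemma E_nonempty: "(1, 0) \<in> E"
  using a_pos[of 1] n_ge_2 by (auto simp: Suc_le_eq V_iff)

lemma gens_cone_sum:
  assumes "finite F" "\<And>f. f \<in> F \<Longrightarrow> h f \<in> gens_cone"
  shows "(\<Sum>f\<in>F. h f) \<in> gens_cone"
  using assms
proof (induction F rule: finite_induct)
  case empty
  \<comment> \<open>Zero is in the cone as 0 times a generator, for which some edge must
    exist.\<close>
  have "edge_vec (1, 0) 1 1 (-1) \<in> gens" unfolding gens_def using E_nonempty by blast
  from gens_cone_gen[OF this, of 0] show ?case by simp
qed (auto intro: gens_cone_add)

text \<open>Solving for the coefficients of the three generators of \<open>f\<close> gives half the
  pairwise sums of \<open>\<alpha>\<close>, \<open>\<beta>\<close> and \<open>\<gamma>\<close>, so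
  the inequalities are their nonnegativity.\<close>

lemma edge_vec_cone:
  assumes f: "f \<in> E" and "0 \<le> \<alpha> + \<beta>" "0 \<le> \<alpha> + \<gamma>" "0 \<le> \<beta> + \<gamma>"
  shows "edge_vec f \<alpha> \<beta> \<gamma> \<in> gens_cone"
proof -
  have eq: "edge_vec f \<alpha> \<beta> \<gamma> = ((\<alpha> + \<beta>) / 2) *\<^sub>R edge_vec f 1 1 (-1)
      + ((\<alpha> + \<gamma>) / 2) *\<^sub>R edge_vec f 1 (-1) 1 + ((\<beta> + \<gamma>) / 2) *\<^sub>R edge_vec f (-1) 1 1"
  proof (rule poly_mapping_eqI)
    fix k
    show "Poly_Mapping.lookup (edge_vec f \<alpha> \<beta> \<gamma>) k = Poly_Mapping.lookup (((\<alpha> + \<beta>) / 2) *\<^sub>R edge_vec f 1 1 (-1)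
      + ((\<alpha> + \<gamma>) / 2) *\<^sub>R edge_vec f 1 (-1) 1 + ((\<beta> + \<gamma>) / 2) *\<^sub>R edge_vec f (-1) 1 1) k"
      by (cases k) (simp_all add: lookup_add lookup_scaleR lookup_edge_vec field_simps)
  qed
  have "edge_vec f 1 1 (-1) \<in> gens" "edge_vec f 1 (-1) 1 \<in> gens" "edge_vec f (-1) 1 1 \<in> gens"
    using f unfolding gens_def by blast+
  then show ?thesis unfolding eq using assms(2-4) by (intro gens_cone_add gens_cone_gen) auto
qed

text \<open>The vector is the sum of its edge contributions: vertex \<open>i\<close> receives
  \<open>\<alpha>\<close> from the edges in position \<open>i\<close> and \<open>\<beta>\<close>
  from those in position \<open>prv i\<close>.\<close>

lemma edge_split_cone:
  assumes "edge_split x \<alpha> \<beta>"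
  shows "x \<in> gens_cone"
proof -
  have "x = (\<Sum>f\<in>E. edge_vec f (\<alpha> f) (\<beta> f) (Poly_Mapping.lookup x (Inr f)))" (is "_ = ?s")
  proof (rule poly_mapping_eqI)
    fix k
    show "Poly_Mapping.lookup x k = Poly_Mapping.lookup ?s k"
    proof (cases k)
      case (Inl i)
      have s: "(\<Sum>f\<in>E. h f) = (\<Sum>j\<in>V. \<Sum>k<a j. h (j, k))" for h :: "nat \<times> nat \<Rightarrow> real"
        by (simp add: sum.Sigma case_prod_unfold)
      have "Poly_Mapping.lookup ?s k = (\<Sum>j\<in>V. \<Sum>k<a j. (if i = j then \<alpha> (j, k) else 0))
          + (\<Sum>j\<in>V. \<Sum>k<a j. (if i = nxt j then \<beta> (j, k) else 0))"
        unfolding Inl lookup_sum lookup_edge_vec sum.distrib s by simp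
      also have "(\<Sum>j\<in>V. \<Sum>k<a j. (if i = j then \<alpha> (j, k) else 0))
          = (\<Sum>j\<in>V. if i = j then (\<Sum>k<a j. \<alpha> (j, k)) else 0)"
        by (intro sum.cong) auto
      also have "\<dots> = (if i \<in> V then (\<Sum>k<a i. \<alpha> (i, k)) else 0)"
        by (simp add: sum.delta')
      also have "(\<Sum>j\<in>V. \<Sum>k<a j. (if i = nxt j then \<beta> (j, k) else 0))
          = (\<Sum>j\<in>V. if i = nxt j then (\<Sum>k<a j. \<beta> (j, k)) else 0)"
        by (intro sum.cong) auto
      also have "\<dots> = (if i \<in> V then (\<Sum>k<a (prv i). \<beta> (prv i, k)) else 0)"
      proof (cases "i \<in> V")
        case True
        then have "(\<Sum>j\<in>V. if i = nxt j then (\<Sum>k<a j. \<beta> (j, k)) else 0)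
            = (\<Sum>j\<in>V. if prv i = j then (\<Sum>k<a j. \<beta> (j, k)) else 0)"
          by (intro sum.cong) (auto simp: prv_eq_iff)
        then show ?thesis using True prv_in[OF True] by (simp add: sum.delta')
      next
        case False
        then have "i \<noteq> nxt j" if "j \<in> V" for j using nxt_in[OF that] by blast
        then have "(\<Sum>j\<in>V. if i = nxt j then (\<Sum>k<a j. \<beta> (j, k)) else 0) = 0"
          by (intro sum.neutral) auto
        then show ?thesis using False by simp
      qed
      finally have s_k: "Poly_Mapping.lookup ?s k = (if i \<in> V then (\<Sum>k<a i. \<alpha> (i, k)) else 0)
          + (if i \<in> V then (\<Sum>k<a (prv i). \<beta> (prv i, k)) else 0)" .
      show ?thesis
      proof (cases "i \<in> V")
        case True
        then have "Poly_Mapping.lookup x (Inl i) = (\<Sum>k<a i. \<alpha> (i, k)) + (\<Sum>k<a (prv i). \<beta> (prv i, k))"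
          using assms unfolding edge_split_def by blast
        then show ?thesis unfolding s_k using True Inl by simp
      next
        case False
        then have "Poly_Mapping.lookup x k = 0"
          using assms Inl unfolding edge_split_def by simp
        then show ?thesis unfolding s_k using False by simp
      qed
    next
      case (Inr e)
      have "Poly_Mapping.lookup ?s k = (if e \<in> E then Poly_Mapping.lookup x (Inr e) else 0)"
        unfolding Inr lookup_sum lookup_edge_vec by (rule sum.delta') simp
      moreover have "Poly_Mapping.lookup x k = 0" if "e \<notin> E"
        using assms Inr that unfolding edge_split_def by simp
      ultimately show ?thesis using Inr by auto
    qed
  qed
  also have "\<dots> \<in> gens_cone"
    using assms unfolding edge_split_def by (intro gens_cone_sum edge_vec_cone) auto
  finally show ?thesis .
qed

text \<open>A split puts \<open>x\<close> in the cone, and comparing coordinate sums shows that the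
  scaling factor is \<open>t\<close>.\<close>

lemma dilate_iff:
  assumes "0 \<le> t"
  shows "x \<in> (\<lambda>x. t *\<^sub>R x) ` (convex hull gens) \<longleftrightarrow> total x = t \<and> (\<exists>\<alpha> \<beta>. edge_split x \<alpha> \<beta>)"
proof
  assume "x \<in> (\<lambda>x. t *\<^sub>R x) ` (convex hull gens)"
  then obtain w where w: "x = t *\<^sub>R w" "w \<in> convex hull gens" by blast
  from edge_split_polytope[OF w(2)] obtain \<alpha> \<beta> where "edge_split w \<alpha> \<beta>" by blast
  from edge_split_scale[OF this assms] show "total x = t \<and> (\<exists>\<alpha> \<beta>. edge_split x \<alpha> \<beta>)"
    using total_polytope[OF w(2)] unfolding w(1) total_simps(2) by auto
next
  assume *: "total x = t \<and> (\<exists>\<alpha> \<beta>. edge_split x \<alpha> \<beta>)"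
  then have "x \<in> gens_cone" using edge_split_cone by blast
  then obtain s w where sw: "x = s *\<^sub>R w" "w \<in> convex hull gens" unfolding gens_cone_def by blast
  then have "s = t" using * total_polytope[OF sw(2)] by (simp add: total_simps)
  then show "x \<in> (\<lambda>x. t *\<^sub>R x) ` (convex hull gens)" using sw by blast
qed

section \<open>Lattice points as flow data\<close>

text \<open>Each edge of a real split carries a flow within its capacity; adding up parallel edges
  gives a real flow on the cycle. As all bounds are integers, rounding down keeps every
  constraint.\<close>

lemma edge_split_imp_flow:
  fixes b :: "nat \<Rightarrow> int" and c :: "nat \<Rightarrow> nat \<Rightarrow> int"
  assumes b: "\<And>i. i \<in> V \<Longrightarrow> Poly_Mapping.lookup x (Inl i) = of_int (b i)"
    and c: "\<And>i k. (i, k) \<in> E \<Longrightarrow> Poly_Mapping.lookup x (Inr (i, k)) = of_int (c i k)"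
    and split: "edge_split x \<alpha> \<beta>"
  shows "\<exists>y :: nat \<Rightarrow> int. \<forall>i\<in>V. \<bar>y i\<bar> \<le> capacity (a i) (c i) \<and>
      y i - y (prv i) \<le> b i - drain (a i) (c i) - drain (a (prv i)) (c (prv i))"
proof -
  \<comment> \<open>With a nonnegative label the edge passes on \<open>\<alpha>\<close>, cut off at
    the capacity. With a negative label this is 0, because \<open>\<alpha>\<close> is at least the
    drain.\<close>
  define \<phi> where "\<phi> i k = min (\<alpha> (i, k) - max (- real_of_int (c i k)) 0) (max (real_of_int (c i k)) 0)" for i k
  define Y where "Y i = (\<Sum>k<a i. \<phi> i k)" for i
  have edge: "- max (real_of_int (c i k)) 0 \<le> \<phi> i k \<and> \<phi> i k \<le> max (real_of_int (c i k)) 0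
      \<and> \<phi> i k + max (- real_of_int (c i k)) 0 \<le> \<alpha> (i, k)
      \<and> max (- real_of_int (c i k)) 0 - \<phi> i k \<le> \<beta> (i, k)" if "i \<in> V" "k < a i" for i k
  proof -
    have "(i, k) \<in> E" using that by simp
    moreover from this have "0 \<le> \<alpha> (i, k) + \<beta> (i, k)" "0 \<le> \<alpha> (i, k) + Poly_Mapping.lookup x (Inr (i, k))"
      "0 \<le> \<beta> (i, k) + Poly_Mapping.lookup x (Inr (i, k))"
      using split unfolding edge_split_def by blast+
    ultimately show ?thesis unfolding \<phi>_def by (auto simp: c min_def max_def)
  qed
  have bounds: "- of_int (capacity (a i) (c i)) \<le> Y i" "Y i \<le> of_int (capacity (a i) (c i))"
    "Y i + of_int (drain (a i) (c i)) \<le> (\<Sum>k<a i. \<alpha> (i, k))"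
    "of_int (drain (a i) (c i)) - Y i \<le> (\<Sum>k<a i. \<beta> (i, k))" if "i \<in> V" for i
    unfolding capacity_of_int drain_of_int Y_def sum_negf[symmetric] sum.distrib[symmetric] sum_subtractf[symmetric]
    by - (rule sum_mono, use edge[OF that] in force)+
  have flow: "Y i \<le> Y (prv i) + of_int (b i - drain (a i) (c i) - drain (a (prv i)) (c (prv i)))"
    if i: "i \<in> V" for i
  proof -
    have "real_of_int (b i) = (\<Sum>k<a i. \<alpha> (i, k)) + (\<Sum>k<a (prv i). \<beta> (prv i, k))"
      using split i b[OF i] unfolding edge_split_def by auto
    then show ?thesis using bounds(3)[OF i] bounds(4)[OF prv_in[OF i]] by simp
  qed
  show ?thesis
  proof (intro exI[of _ "\<lambda>i. \<lfloor>Y i\<rfloor>"] ballI conjI)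
    fix i assume i: "i \<in> V"
    show "\<bar>\<lfloor>Y i\<rfloor>\<bar> \<le> capacity (a i) (c i)"
    proof -
      have "- capacity (a i) (c i) \<le> \<lfloor>Y i\<rfloor>" using bounds(1)[OF i] by (simp add: le_floor_iff)
      then show ?thesis using floor_mono[OF bounds(2)[OF i]] by simp
    qed
    show "\<lfloor>Y i\<rfloor> - \<lfloor>Y (prv i)\<rfloor> \<le> b i - drain (a i) (c i) - drain (a (prv i)) (c (prv i))"
      using floor_mono[OF flow[OF i]] unfolding floor_add_int[symmetric] by simp
  qed
qed

text \<open>Converse of \<open>edge_split_imp_flow\<close>. Even for an integral point the split may
  be real, so the flow can be divided among parallel edges in any ratio.\<close>

lemma flow_imp_edge_split:
  fixes b y :: "nat \<Rightarrow> int" and c :: "nat \<Rightarrow> nat \<Rightarrow> int"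
  assumes supp: "\<And>k. k \<notin> coords \<Longrightarrow> Poly_Mapping.lookup x k = 0"
    and b: "\<And>i. i \<in> V \<Longrightarrow> Poly_Mapping.lookup x (Inl i) = of_int (b i)"
    and c: "\<And>i k. (i, k) \<in> E \<Longrightarrow> Poly_Mapping.lookup x (Inr (i, k)) = of_int (c i k)"
    and y: "\<And>i. i \<in> V \<Longrightarrow> \<bar>y i\<bar> \<le> capacity (a i) (c i)"
      "\<And>i. i \<in> V \<Longrightarrow> y i - y (prv i) \<le> b i - drain (a i) (c i) - drain (a (prv i)) (c (prv i))"
  shows "\<exists>\<alpha> \<beta>. edge_split x \<alpha> \<beta>"
proof -
  define p where "p i = b i - drain (a i) (c i) - drain (a (prv i)) (c (prv i)) - y i + y (prv i)" for i
  \<comment> \<open>If the capacity is 0, so is \<open>y i\<close>, and division by zero yields the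
    suitable value 0.\<close>
  define r where "r i = real_of_int (y i) / of_int (capacity (a i) (c i))" for i
  define cp where "cp i k = max (real_of_int (c i k)) 0" for i k
  define cm where "cm i k = max (- real_of_int (c i k)) 0" for i k
  \<comment> \<open>The flow at \<open>i\<close> is shared among the parallel edges in proportion to their capacities, and the
    leftover at \<open>i\<close> is charged to the edge \<open>(i, 0)\<close>.\<close>
  define \<alpha> where "\<alpha> = (\<lambda>(i, k). cm i k + cp i k * r i + (if k = 0 then real_of_int (p i) else 0))"
  define \<beta> where "\<beta> = (\<lambda>(i, k). cm i k - cp i k * r i)"
  have r: "\<bar>r i\<bar> \<le> 1" if "i \<in> V" for i
  proof -
    have "real_of_int \<bar>y i\<bar> \<le> real_of_int (capacity (a i) (c i))" using y(1)[OF that] by (simp only: of_int_le_iff)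
    then show ?thesis unfolding r_def
      using capacity_nonneg[of "a i" "c i"] by (auto simp: divide_le_eq_1 order_le_less)
  qed
  have sum_r: "(\<Sum>k<a i. cp i k * r i) = of_int (y i)" if "i \<in> V" for i
  proof -
    have "(\<Sum>k<a i. cp i k * r i) = of_int (capacity (a i) (c i)) * r i"
      unfolding capacity_of_int cp_def by (simp add: sum_distrib_right)
    also have "\<dots> = of_int (y i)" using y(1)[OF that] unfolding r_def by auto
    finally show ?thesis .
  qed
  have sum_cm: "(\<Sum>k<a i. cm i k) = of_int (drain (a i) (c i))" for i
    unfolding drain_of_int cm_def by simp
  have p0: "0 \<le> real_of_int (p i)" if "i \<in> V" for i using y(2)[OF that] by (simp add: p_def)
  have "edge_split x \<alpha> \<beta>"
    unfolding edge_split_def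
  proof (intro conjI ballI allI impI)
    fix f assume "f \<in> E"
    then obtain i k where f: "f = (i, k)" "(i, k) \<in> E" "i \<in> V" by auto
    have "\<bar>cp i k * r i\<bar> \<le> cp i k"
      using mult_left_mono[OF r[OF f(3)], of "cp i k"] by (simp add: abs_mult cp_def)
    moreover have "0 \<le> cm i k" "cm i k + of_int (c i k) = cp i k" by (auto simp: cm_def cp_def)
    moreover have "0 \<le> (if k = 0 then real_of_int (p i) else 0)" using p0[OF f(3)] by simp
    ultimately show "0 \<le> \<alpha> f + \<beta> f" "0 \<le> \<alpha> f + Poly_Mapping.lookup x (Inr f)"
      "0 \<le> \<beta> f + Poly_Mapping.lookup x (Inr f)"
      unfolding f(1) c[OF f(2)] \<alpha>_def \<beta>_def prod.case by linarith+
  next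
    fix i assume i: "i \<in> V"
    \<comment> \<open>The edge \<open>(i, 0)\<close> must exist to absorb the leftover.\<close>
    have "a i \<ge> 1" using a_pos i by (simp add: V_def)
    then have "(\<Sum>k<a i. if k = 0 then real_of_int (p i) else 0) = of_int (p i)" by simp
    then have "(\<Sum>k<a i. \<alpha> (i, k)) = of_int (drain (a i) (c i) + y i + p i)"
      unfolding \<alpha>_def prod.case sum.distrib sum_cm sum_r[OF i] by simp
    moreover have "(\<Sum>k<a (prv i). \<beta> (prv i, k)) = of_int (drain (a (prv i)) (c (prv i)) - y (prv i))"
      unfolding \<beta>_def prod.case sum_subtractf sum_cm sum_r[OF prv_in[OF i]] by simp
    ultimately show "Poly_Mapping.lookup x (Inl i) = (\<Sum>k<a i. \<alpha> (i, k)) + (\<Sum>k<a (prv i). \<beta> (prv i, k))"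
      unfolding b[OF i] by (simp add: p_def)
  qed (rule supp)
  then show ?thesis by blast
qed

section \<open>From flow data to lattice points\<close>

definition label :: "(nat \<Rightarrow> (nat \<Rightarrow> int) \<times> int \<times> nat) \<Rightarrow> nat \<Rightarrow> nat \<Rightarrow> int" where
  "label g i = fst (g i)"

definition flow :: "(nat \<Rightarrow> (nat \<Rightarrow> int) \<times> int \<times> nat) \<Rightarrow> nat \<Rightarrow> int" where
  "flow g i = fst (snd (g i))"

definition slack :: "(nat \<Rightarrow> (nat \<Rightarrow> int) \<times> int \<times> nat) \<Rightarrow> nat \<Rightarrow> int" where
  "slack g i = int (snd (snd (g i)))"

text \<open>This is the balance of the transport problem at \<open>i\<close>, solved for the vertex
  coordinate.\<close>

definition vertex_coord :: "(nat \<Rightarrow> (nat \<Rightarrow> int) \<times> int \<times> nat) \<Rightarrow> nat \<Rightarrow> int" where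
  "vertex_coord g i = slack g i + drain (a i) (label g i) + drain (a (prv i)) (label g (prv i))
     + flow g i - flow g (prv i)"

definition point :: "(nat \<Rightarrow> (nat \<Rightarrow> int) \<times> int \<times> nat) \<Rightarrow> (nat + nat \<times> nat \<Rightarrow>\<^sub>0 real)" where
  "point g = (\<Sum>i\<in>V. Poly_Mapping.single (Inl i) (of_int (vertex_coord g i)))
     + (\<Sum>f\<in>E. Poly_Mapping.single (Inr f) (of_int (label g (fst f) (snd f))))"

lemma lookup_point_Inl:
  "Poly_Mapping.lookup (point g) (Inl i) = (if i \<in> V then of_int (vertex_coord g i) else 0)"
proof -
  have "Poly_Mapping.lookup (point g) (Inl i)
      = (\<Sum>j\<in>V. if j = i then real_of_int (vertex_coord g j) else 0)"
    by (simp add: point_def lookup_add lookup_sum lookup_single when_def)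
  then show ?thesis by simp
qed

lemma lookup_point_Inr:
  "Poly_Mapping.lookup (point g) (Inr f) = (if f \<in> E then of_int (label g (fst f) (snd f)) else 0)"
proof -
  have "Poly_Mapping.lookup (point g) (Inr f)
      = (\<Sum>e\<in>E. if e = f then real_of_int (label g (fst e) (snd e)) else 0)"
    by (simp add: point_def lookup_add lookup_sum lookup_single when_def)
  also have "\<dots> = (if f \<in> E then of_int (label g (fst f) (snd f)) else 0)"
    by (rule sum.delta) simp
  finally show ?thesis .
qed

lemma point_supp: "k \<notin> coords \<Longrightarrow> Poly_Mapping.lookup (point g) k = 0"
  by (cases k) (simp_all add: lookup_point_Inl lookup_point_Inr del: mem_Sigma_iff)

definition weight :: "(nat \<Rightarrow> (nat \<Rightarrow> int) \<times> int \<times> nat) \<Rightarrow> nat" where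
  "weight g = (\<Sum>i\<in>V. data_weight (a i) (g i))"

text \<open>Flows cancel around the cycle and every drain is counted at both ends of its edge. The
  label sum, capacity minus drain, takes one drain away again, which leaves leftover plus label
  weight.\<close>

lemma total_point: "total (point g) = real (weight g)"
proof -
  have "(\<Sum>k\<in>coords. Poly_Mapping.lookup (point g) k)
      = real_of_int ((\<Sum>i\<in>V. vertex_coord g i) + (\<Sum>i\<in>V. \<Sum>k<a i. label g i k))"
    unfolding sum_coords by (simp add: lookup_point_Inl lookup_point_Inr)
  also have "(\<Sum>i\<in>V. vertex_coord g i)
      = (\<Sum>i\<in>V. slack g i + 2 * drain (a i) (label g i))"
    using sum_prv[of "\<lambda>i. drain (a i) (label g i)"] sum_prv[of "flow g"]
    by (simp add: vertex_coord_def sum.distrib sum_subtractf sum_distrib_left[symmetric])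
  also have "\<dots> + (\<Sum>i\<in>V. \<Sum>k<a i. label g i k)
      = (\<Sum>i\<in>V. slack g i + capacity (a i) (label g i) + drain (a i) (label g i))"
    unfolding capacity_minus_drain[symmetric] by (simp add: sum.distrib[symmetric] algebra_simps)
  also have "\<dots> = int (weight g)"
    unfolding weight_def
    by (simp add: data_weight_def case_prod_unfold label_weight_eq slack_def label_def algebra_simps)
  finally show ?thesis unfolding total_def by simp
qed

definition cycle_data :: "(nat \<Rightarrow> (nat \<Rightarrow> int) \<times> int \<times> nat) set" where
  "cycle_data = PiE V (\<lambda>i. flow_data (a i)) - PiE V (\<lambda>i. unsaturated_data (a i))"

lemma cycle_dataD:
  assumes "g \<in> cycle_data"
  shows "\<And>i. i \<in> V \<Longrightarrow> label g i \<in> edge_labels (a i)"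
    and "\<And>i. i \<in> V \<Longrightarrow> \<bar>flow g i\<bar> \<le> capacity (a i) (label g i)"
    and "\<And>i. i \<in> V \<Longrightarrow> slack g i = 0 \<or> flow g i = capacity (a i) (label g i)"
    and "\<exists>i\<in>V. flow g i = capacity (a i) (label g i)"
    and "g \<in> extensional V"
proof -
  have g: "g i \<in> flow_data (a i)" if "i \<in> V" for i
    using assms that by (auto simp: cycle_data_def)
  then show *: "\<And>i. i \<in> V \<Longrightarrow> label g i \<in> edge_labels (a i)"
    "\<And>i. i \<in> V \<Longrightarrow> \<bar>flow g i\<bar> \<le> capacity (a i) (label g i)"
    "\<And>i. i \<in> V \<Longrightarrow> slack g i = 0 \<or> flow g i = capacity (a i) (label g i)"
    by (force simp: flow_data_def label_def flow_def slack_def)+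
  show ext: "g \<in> extensional V" using assms by (simp add: cycle_data_def PiE_iff)
  \<comment> \<open>If every flow differed from its capacity, all would lie strictly below, and
    \<open>g\<close> would belong to the excluded product.\<close>
  show "\<exists>i\<in>V. flow g i = capacity (a i) (label g i)"
  proof (rule ccontr)
    assume neg: "\<not> ?thesis"
    have "g i \<in> unsaturated_data (a i)" if "i \<in> V" for i
    proof -
      have "flow g i < capacity (a i) (label g i)" using neg that *(2)[OF that] by force
      then show ?thesis using g[OF that] by (auto simp: unsaturated_data_def flow_def label_def case_prod_unfold)
    qed
    then show False using assms ext by (auto simp: cycle_data_def PiE_iff)
  qed
qed

text \<open>The edge coordinates determine the labels. Two flows for the same point then solve the
  same transport problem, both with a saturated vertex, so each dominates the other; the leftovers
  follow from the balance.\<close>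

lemma inj_point: "inj_on point cycle_data"
proof (rule inj_onI)
  fix g h assume g: "g \<in> cycle_data" and h: "h \<in> cycle_data" and eq: "point g = point h"
  have lab: "label g i = label h i" if i: "i \<in> V" for i
  proof -
    have "label g i k = label h i k" if "k < a i" for k
      using lookup_point_Inr[of g "(i, k)"] lookup_point_Inr[of h "(i, k)"] eq i that by simp
    then show ?thesis
      using cycle_dataD(1)[OF g i] cycle_dataD(1)[OF h i]
      unfolding edge_labels_def by (intro PiE_ext) auto
  qed
  have vc: "vertex_coord g i = vertex_coord h i" if "i \<in> V" for i
    using lookup_point_Inl[of g i] lookup_point_Inl[of h i] eq that by simp
  have le: "flow h j \<le> flow g j"
    if g: "g \<in> cycle_data" and h: "h \<in> cycle_data" and lab: "\<And>i. i \<in> V \<Longrightarrow> label g i = label h i"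
      and vc: "\<And>i. i \<in> V \<Longrightarrow> vertex_coord g i = vertex_coord h i" and j: "j \<in> V" for g h j
  proof -
    obtain i where i: "i \<in> V" "flow g i = capacity (a i) (label g i)" using cycle_dataD(4)[OF g] by blast
    show ?thesis
    \<comment> \<open>Here \<open>b\<close> is the vertex coordinate of \<open>g\<close> minus the
      adjacent drains, and \<open>h\<close> has the same value there.\<close>
    proof (rule saturated_flow_le[where b = "\<lambda>i. slack g i + flow g i - flow g (prv i)" and p = "slack g"
          and C = "\<lambda>i. capacity (a i) (label g i)", OF refl _ i _ _ j])
      fix i assume i: "i \<in> V"
      show "slack g i = 0 \<or> flow g i = capacity (a i) (label g i)" by (rule cycle_dataD(3)[OF g i])
      show "flow h i \<le> capacity (a i) (label g i)" using cycle_dataD(2)[OF h i] lab[OF i] by simp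
      have "0 \<le> slack h i" by (simp add: slack_def)
      then show "flow h i - flow h (prv i) \<le> slack g i + flow g i - flow g (prv i)"
        using vc[OF i] lab[OF i] lab[OF prv_in[OF i]] unfolding vertex_coord_def by simp
    qed
  qed
  have fl: "flow g i = flow h i" if i: "i \<in> V" for i
    using le[OF g h lab vc i] le[OF h g lab[symmetric] vc[symmetric] i] by simp
  have "slack g i = slack h i" if i: "i \<in> V" for i
    using vc[OF i] fl[OF i] fl[OF prv_in[OF i]] lab[OF i] lab[OF prv_in[OF i]]
    unfolding vertex_coord_def by simp
  then have "g i = h i" if "i \<in> V" for i
    using lab[OF that] fl[OF that] that by (simp add: prod_eq_iff label_def flow_def slack_def)
  then show "g = h"
    using cycle_dataD(5)[OF g] cycle_dataD(5)[OF h] by (rule extensionalityI[rotated 2])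
qed

lemma point_in_dilate:
  assumes "g \<in> cycle_data"
  shows "point g \<in> (\<lambda>x. real (weight g) *\<^sub>R x) ` (convex hull gens) \<inter> integer_points"
proof
  have "\<exists>\<alpha> \<beta>. edge_split (point g) \<alpha> \<beta>"
  proof (rule flow_imp_edge_split)
    fix i assume i: "i \<in> V"
    show "\<bar>flow g i\<bar> \<le> capacity (a i) (label g i)" by (rule cycle_dataD(2)[OF assms i])
    show "flow g i - flow g (prv i)
        \<le> vertex_coord g i - drain (a i) (label g i) - drain (a (prv i)) (label g (prv i))"
      by (simp add: vertex_coord_def slack_def)
  qed (simp_all add: lookup_point_Inl lookup_point_Inr point_supp)
  then show "point g \<in> (\<lambda>x. real (weight g) *\<^sub>R x) ` (convex hull gens)"
    by (subst dilate_iff) (simp_all add: total_point)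
  have "Poly_Mapping.lookup (point g) k \<in> \<int>" for k
    by (cases k) (simp_all add: lookup_point_Inl lookup_point_Inr)
  then show "point g \<in> integer_points" by (simp add: integer_points_def)
qed

text \<open>A split of \<open>x\<close> yields an integral flow by
  \<open>edge_split_imp_flow\<close>, and \<open>ex_saturated_flow\<close> replaces it by a
  saturated one, which supplies the data.\<close>

lemma dilate_subset_point:
  assumes x: "x \<in> (\<lambda>x. real t *\<^sub>R x) ` (convex hull gens) \<inter> integer_points"
  shows "\<exists>g\<in>cycle_data. weight g = t \<and> point g = x"
proof -
  from x obtain \<alpha> \<beta> where tot: "total x = t" and split: "edge_split x \<alpha> \<beta>"
    using dilate_iff[of "real t" x] by auto
  define b where "b i = \<lfloor>Poly_Mapping.lookup x (Inl i)\<rfloor>" for i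
  define c where "c i k = \<lfloor>Poly_Mapping.lookup x (Inr (i, k))\<rfloor>" for i k
  have b: "Poly_Mapping.lookup x (Inl i) = of_int (b i)"
    and c: "Poly_Mapping.lookup x (Inr (i, k)) = of_int (c i k)" for i k
    using x by (auto simp: integer_points_def b_def c_def)
  let ?C = "\<lambda>i. capacity (a i) (c i)"
  let ?b = "\<lambda>i. b i - drain (a i) (c i) - drain (a (prv i)) (c (prv i))"
  obtain y where y: "\<And>i. i \<in> V \<Longrightarrow> \<bar>y i\<bar> \<le> ?C i \<and> y i - y (prv i) \<le> ?b i \<and> (?b i = y i - y (prv i) \<or> y i = ?C i)"
    and sat: "\<exists>i\<in>V. y i = ?C i"
    using ex_saturated_flow[OF edge_split_imp_flow[OF b c split]] by blast
  \<comment> \<open>The argument of \<open>nat\<close> is nonnegative by the admissibility of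
    \<open>y\<close>. Restricting the labels puts them into \<open>edge_labels\<close>.\<close>
  define g where "g = (\<lambda>i\<in>V. (restrict (c i) {..<a i}, y i, nat (?b i - y i + y (prv i))))"
  have lab: "label g i k = c i k" if "i \<in> V" "k < a i" for i k
    using that by (simp add: g_def label_def)
  have cap: "capacity (a i) (label g i) = ?C i" and dr: "drain (a i) (label g i) = drain (a i) (c i)"
    if "i \<in> V" for i
    using lab[OF that] by (auto intro: capacity_cong drain_cong)
  have fl: "flow g i = y i" and sl: "slack g i = ?b i - y i + y (prv i)" if "i \<in> V" for i
    using that y[OF that] by (simp_all add: g_def flow_def slack_def)
  have vc: "vertex_coord g i = b i" if i: "i \<in> V" for i
    using fl[OF i] fl[OF prv_in[OF i]] sl[OF i] dr[OF i] dr[OF prv_in[OF i]]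
    by (simp add: vertex_coord_def)
  have "g \<in> PiE V (\<lambda>i. flow_data (a i))"
  proof (rule PiE_I)
    fix i assume i: "i \<in> V"
    have "label g i \<in> edge_labels (a i)" using i by (simp add: g_def label_def edge_labels_def)
    then show "g i \<in> flow_data (a i)"
      using y[OF i] cap[OF i] fl[OF i] sl[OF i]
      by (auto simp: flow_data_def case_prod_unfold label_def flow_def slack_def)
  qed (simp add: g_def)
  moreover have "g \<notin> PiE V (\<lambda>i. unsaturated_data (a i))"
  proof
    assume "g \<in> PiE V (\<lambda>i. unsaturated_data (a i))"
    then have "flow g i < capacity (a i) (label g i)" if "i \<in> V" for i
      using PiE_mem[OF _ that] by (fastforce simp: unsaturated_data_def flow_def label_def)
    then show False using sat fl cap by force
  qed
  ultimately have "g \<in> cycle_data" by (simp add: cycle_data_def)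
  moreover have eq: "point g = x"
  proof (rule poly_mapping_eqI)
    fix k
    show "Poly_Mapping.lookup (point g) k = Poly_Mapping.lookup x k"
    proof (cases "k \<in> coords")
      case True
      then show ?thesis
        by (cases k) (auto simp: lookup_point_Inl lookup_point_Inr vc lab b c)
    next
      case False
      then show ?thesis using split by (simp add: point_supp edge_split_def)
    qed
  qed
  moreover have "weight g = t" using total_point[of g] tot unfolding eq by simp
  ultimately show ?thesis by blast
qed

section \<open>Ehrhart series, dimension and the final formula\<close>

lemma card_dilate:
  "card ((\<lambda>x. real t *\<^sub>R x) ` (convex hull gens) \<inter> integer_points) = card {g \<in> cycle_data. weight g = t}"
proof -
  have "bij_betw point {g \<in> cycle_data. weight g = t} ((\<lambda>x. real t *\<^sub>R x) ` (convex hull gens) \<inter> integer_points)"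
    unfolding bij_betw_def
  proof (intro conjI equalityI subsetI)
    show "inj_on point {g \<in> cycle_data. weight g = t}"
      by (rule inj_on_subset[OF inj_point]) auto
    fix x assume "x \<in> (\<lambda>x. real t *\<^sub>R x) ` (convex hull gens) \<inter> integer_points"
    from dilate_subset_point[OF this] show "x \<in> point ` {g \<in> cycle_data. weight g = t}" by blast
  next
    fix x assume "x \<in> point ` {g \<in> cycle_data. weight g = t}"
    then show "x \<in> (\<lambda>x. real t *\<^sub>R x) ` (convex hull gens) \<inter> integer_points"
      using point_in_dilate by blast
  qed
  from bij_betw_same_card[OF this] show ?thesis by simp
qed

lemma ehrhart_series_gens:
  "ehrhart_series (convex hull gens) = weight_series cycle_data weight (\<lambda>_. 1)"
proof (rule fps_ext)
  fix t
  \<comment> \<open>The constant term is 1 by definition. It agrees with the count at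
    \<open>t = 0\<close> because the hull is nonempty and its zero dilate is the origin.\<close>
  have "edge_vec (1, 0) 1 1 (-1) \<in> convex hull gens"
    by (rule hull_inc) (use E_nonempty in \<open>auto simp: gens_def\<close>)
  then have "(\<lambda>x. real 0 *\<^sub>R x) ` (convex hull gens) \<inter> integer_points = {0}"
    by (auto simp: integer_points_def image_iff)
  then have "card ((\<lambda>x. real 0 *\<^sub>R x) ` (convex hull gens) \<inter> integer_points) = 1"
    by (simp only: card.empty card.insert finite.emptyI empty_iff) simp
  then show "ehrhart_series (convex hull gens) $ t = weight_series cycle_data weight (\<lambda>_. 1) $ t"
    using card_dilate[of t] by (cases "t = 0") (simp_all add: ehrhart_series_def weight_series_one_nth)
qed

text \<open>Every unit vector is the midpoint of two generators of one edge: a vertex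
  \<open>i\<close> uses the edge \<open>(i, 0)\<close>, an edge uses itself.\<close>

lemma unit_vec_polytope:
  assumes "k \<in> coords"
  shows "unit_vec k \<in> convex hull gens"
proof -
  have "\<exists>\<alpha> \<beta>. edge_split (unit_vec k) \<alpha> \<beta>"
  proof (cases k)
    case (Inl i)
    then have "(i, 0) \<in> E" using assms a_pos[of i] by (simp add: V_def Suc_le_eq)
    from edge_split_edge_vec[OF this, of 1 0 0] show ?thesis
      unfolding Inl by (auto simp: edge_vec_def)
  next
    case (Inr f)
    then have "f \<in> E" using assms by (simp del: mem_Sigma_iff)
    from edge_split_edge_vec[OF this, of 0 0 1] show ?thesis
      unfolding Inr by (auto simp: edge_vec_def)
  qed
  then have "unit_vec k \<in> (\<lambda>x. 1 *\<^sub>R x) ` (convex hull gens)"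
    using total_simps(3)[OF assms, of 1] by (subst dilate_iff) auto
  then show ?thesis by simp
qed

lemma affine_dim_gens: "affine_dim (convex hull gens) + 1 = (\<Sum>i\<in>V. a i + 1)"
proof -
  have "card coords = card (Inl ` V :: (nat + nat \<times> nat) set) + card (Inr ` E :: (nat + nat \<times> nat) set)"
    unfolding coords_def by (rule card_Un_disjoint) auto
  then have card: "card coords = (\<Sum>i\<in>V. a i + 1)"
    by (simp add: card_image card_V sum_Suc)
  have pos: "coords \<noteq> {}" using E_nonempty Inr_coords by blast
  have "affine_dim (convex hull gens) = card coords - 1"
  proof (rule affine_dim_eq[OF finite_coords pos unit_vec_polytope])
    fix x assume x: "x \<in> convex hull gens"
    show "(\<Sum>k\<in>coords. Poly_Mapping.lookup x k) = 1"
      using total_polytope[OF x] by (simp add: total_def)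
    show "Poly_Mapping.lookup x k = 0" if "k \<notin> coords" for k
      using edge_split_polytope[OF x] that unfolding edge_split_def by blast
  qed
  moreover have "card coords > 0" using pos finite_coords by (simp add: card_gt_0_iff)
  ultimately show ?thesis using card by simp
qed

lemma hstar_multicycle:
  "hstar (cosmological_polytope (multicycle n a)) =
    (\<Prod>i=1..n. (1 + fps_X) ^ a i + 2 * of_nat (a i) * fps_X * (1 + fps_X) ^ (a i - 1))
    - (\<Prod>i=1..n. 2 * of_nat (a i) * fps_X * (1 + fps_X) ^ (a i - 1))"
  unfolding hstar_def cosmological_polytope_multicycle affine_dim_gens ehrhart_series_gens
  using flow_minus_unsaturated_series[OF finite_V, of a]
  by (simp add: cycle_data_def V_def weight_def[abs_def])

end

theorem theorem4p6:
  fixes n :: nat and a :: "nat \<Rightarrow> nat"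
  assumes "n \<ge> 3" and "\<And>i. i \<in> {1..n} \<Longrightarrow> a i \<ge> 1"
  shows "hstar (cosmological_polytope (multicycle n a)) =
    (\<Prod>i=1..n. (1 + fps_X) ^ a i + 2 * of_nat (a i) * fps_X * (1 + fps_X) ^ (a i - 1))
    - (\<Prod>i=1..n. 2 * of_nat (a i) * fps_X * (1 + fps_X) ^ (a i - 1))"
proof -
  interpret multicycle_polytope n a
    by standard (use assms in auto)
  show ?thesis by (rule hstar_multicycle)
qed

end
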